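(* Let $(\lambda_n)_{n\ge1}\in\ell^2\setminus\ell^1$ be a sequence of positive step sizes, let $(\varepsilon_k)_{k\ge1}$ be a sequence in $X$ with $\sum_{k\ge1}\|\varepsilon_k\|<+\infty$, and let $(x_k)_{k\ge0}$ be a sequence in $X$ satisfying $$-\frac{x_k-x_{k-1}}{\lambda_k}+\varepsilon_k\in Ax_k+Bx_{k-1},\qquad k\ge1.$$ Set $\mathcal A=A+B$ and $\Sigma=\mathcal A^{-1}0=\{x\in X:0\in\mathcal Ax\}$, and assume $\Sigma\ne\emptyset$. Assume one of the following conditions holds: (i) there is $\alpha>0$ such that for every $x\notin\Sigma$ and every $y\in\mathcal Ax$, $\langle j(x-P_\Sigma x),y\rangle\ge\alpha\|x-P_\Sigma x\|^2$; (ii) $J_1$ is compact and, for every $x\notin\Sigma$ and every $y\in\mathcal Ax$, $\langle j(x-P_\Sigma x),y\rangle>0$; or (iii) the interior of $\Sigma$ is not empty. Then $x_n$ converges strongly, as $n\to+\infty$, to a point in $\Sigma$.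
   Context: $X$ is a uniformly convex Banach space whose dual $X^*$ is 2-uniformly convex. Consequently $X$ is reflexive, the duality mapping $j:X\to X^*$, $j(x)=\{x^*\in X^*:\langle x^*,x\rangle=\|x\|^2=\|x^*\|_*^2\}$, is single-valued, and there is a constant $\kappa>0$ such that $\|u+v\|^2\le\|u\|^2+2\langle j(u),v\rangle+\kappa\|v\|^2$ for all $u,v\in X$. $A:X\to 2^X$ is a set-valued operator. It is m-accretive: accretive means $\|x-y+\lambda(u-v)\|\ge\|x-y\|$ for all $\lambda>0$ whenever $u\in Ax$, $v\in Ay$ (equivalently, $\langle j(x-y),u-v\rangle\ge0$ whenever $u\in Ax$, $v\in Ay$), and m-accretive means that, moreover, $I+\lambda A$ is surjective for all $\lambda>0$. Its resolvent $J_\lambda=(I+\lambda A)^{-1}$ is single-valued and everywhere defined; in particular $J_1=(I+A)^{-1}$. $B:X\to X$ is cocoercive with parameter $\theta>0$: $\langle j(x-y),Bx-By\rangle\ge\theta\|Bx-By\|^2$ for all $x,y\in X$. The set $\Sigma$ is closed and convex, and $P_\Sigma$ denotes the (well-defined, single-valued, continuous) nearest-point projection onto $\Sigma$. *)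

theory Defs
  imports "HOL-Analysis.Analysis"
begin

text \<open>
  The modulus of convexity takes values in the extended reals, so that the infimum over the
  empty set (which occurs only in the trivial space when \<open>0 < e \<le> 2\<close>) is infinite and the
  trivial space counts as uniformly convex.
\<close>
definition modulus_of_convexity :: "'a::real_normed_vector itself \<Rightarrow> real \<Rightarrow> ereal" where
  "modulus_of_convexity T e =
     Inf {ereal (1 - norm ((x + y) /\<^sub>R 2)) | x y :: 'a.
            norm x = 1 \<and> norm y = 1 \<and> norm (x - y) \<ge> e}"

definition uniformly_convex_space :: "'a::real_normed_vector itself \<Rightarrow> bool" where
  "uniformly_convex_space T \<longleftrightarrow> (\<forall>e. 0 < e \<and> e \<le> 2 \<longrightarrow> modulus_of_convexity T e > 0)"

definition two_uniformly_convex_space :: "'a::real_normed_vector itself \<Rightarrow> bool" where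
  "two_uniformly_convex_space T \<longleftrightarrow>
     (\<exists>c>0. \<forall>e. 0 < e \<and> e \<le> 2 \<longrightarrow> modulus_of_convexity T e \<ge> ereal (c * e\<^sup>2))"

definition duality_set :: "'a::real_normed_vector \<Rightarrow> ('a \<Rightarrow>\<^sub>L real) set" where
  "duality_set x = {f. blinfun_apply f x = (norm x)\<^sup>2 \<and> (norm x)\<^sup>2 = (norm f)\<^sup>2}"

text \<open>Meaningful when the duality set is a singleton, e.g. when the dual space is strictly convex.\<close>
definition duality_map :: "'a::real_normed_vector \<Rightarrow> ('a \<Rightarrow>\<^sub>L real)" where
  "duality_map x = the_elem (duality_set x)"

definition accretive :: "('a::real_normed_vector \<Rightarrow> 'a set) \<Rightarrow> bool" where
  "accretive A \<longleftrightarrow>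
     (\<forall>x y. \<forall>u\<in>A x. \<forall>v\<in>A y. \<forall>l>0. norm (x - y + l *\<^sub>R (u - v)) \<ge> norm (x - y))"

definition m_accretive :: "('a::real_normed_vector \<Rightarrow> 'a set) \<Rightarrow> bool" where
  "m_accretive A \<longleftrightarrow> accretive A \<and> (\<forall>l>0. \<forall>z. \<exists>x. \<exists>u\<in>A x. z = x + l *\<^sub>R u)"

text \<open>The inverse of \<open>I + l A\<close>; single-valued and total when \<open>A\<close> is m-accretive and \<open>l > 0\<close>.\<close>
definition resolvent :: "('a::real_normed_vector \<Rightarrow> 'a set) \<Rightarrow> real \<Rightarrow> 'a \<Rightarrow> 'a" where
  "resolvent A l z = (THE x. \<exists>u\<in>A x. z = x + l *\<^sub>R u)"

definition cocoercive :: "('a::real_normed_vector \<Rightarrow> 'a) \<Rightarrow> real \<Rightarrow> bool" where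
  "cocoercive B \<theta> \<longleftrightarrow>
     (\<forall>x y. blinfun_apply (duality_map (x - y)) (B x - B y) \<ge> \<theta> * (norm (B x - B y))\<^sup>2)"

definition operator_sum :: "('a::real_normed_vector \<Rightarrow> 'a set) \<Rightarrow> ('a \<Rightarrow> 'a) \<Rightarrow> 'a \<Rightarrow> 'a set" where
  "operator_sum A B x = {u + B x | u. u \<in> A x}"

definition zeros :: "('a::real_normed_vector \<Rightarrow> 'a set) \<Rightarrow> 'a set" where
  "zeros A = {x. 0 \<in> A x}"

text \<open>The library's \<open>closest_point\<close> is confined to inner product spaces with the Heine-Borel property.\<close>
definition nearest_point :: "'a::real_normed_vector set \<Rightarrow> 'a \<Rightarrow> 'a" where
  "nearest_point S x = (THE p. p \<in> S \<and> (\<forall>q\<in>S. norm (x - p) \<le> norm (x - q)))"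

text \<open>Continuity is not included; resolvents of accretive operators are automatically nonexpansive.\<close>
definition compact_map :: "('a::real_normed_vector \<Rightarrow> 'a) \<Rightarrow> bool" where
  "compact_map T \<longleftrightarrow> (\<forall>S. bounded S \<longrightarrow> compact (closure (T ` S)))"

end

theory Submission
  imports Defs
begin

text \<open>
  Duality with the quadratic convexity of the norm of \<open>X\<^sup>*\<close> makes \<open>j\<close> Lipschitz and yields the smoothness
  inequality for the norm of \<open>X\<close>. Hence \<open>I - \<lambda>B\<close> is nonexpansive for small \<open>\<lambda>\<close>, the set \<open>\<Sigma>\<close> of fixed
  points of \<open>J\<^sub>\<lambda> \<circ> (I - \<lambda>B)\<close> is closed and convex, and the iterates are quasi-Fejer with respect to \<open>\<Sigma>\<close>.
  Comparing consecutive inclusions bounds \<open>norm (x\<^sub>k - x\<^sub>k\<^sub>-\<^sub>1) / \<lambda>\<^sub>k\<close>, so the error made by evaluating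
  \<open>B\<close> at the old iterate is \<open>O(\<lambda>\<^sub>k\<^sup>2)\<close> and summable. Since half the squared distance to \<open>\<Sigma>\<close> has
  subgradient \<open>j (x - P x)\<close>, the numbers \<open>\<lambda>\<^sub>k \<langle>j (x\<^sub>k - P x\<^sub>k), y\<^sub>k\<rangle>\<close> with \<open>y\<^sub>k \<in> (A + B) x\<^sub>k\<close> are summable,
  and as \<open>\<Sum>\<lambda>\<^sub>k = \<infinity>\<close> the pairing tends to 0 along a subsequence. In cases (i) and (ii) this
  forces the distance to \<open>\<Sigma>\<close> to 0, which for a quasi-Fejer sequence means strong convergence.
  In case (iii) the steps themselves are absolutely summable.
\<close>

section \<open>Norming functionals\<close>

text \<open>Scaling is asked only as an inequality for \<open>t > 0\<close>, a form that passes
  directly to infima; applying it again with \<open>1/t\<close> recovers equality.\<close>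

definition sublinear :: "('a::real_normed_vector \<Rightarrow> real) \<Rightarrow> bool" where
  "sublinear p \<longleftrightarrow> (\<forall>x y. p (x + y) \<le> p x + p y) \<and> (\<forall>t>0. \<forall>x. p (t *\<^sub>R x) \<le> t * p x)"

lemma sublinear_zero:
  assumes "sublinear p" shows "p 0 = 0"
proof -
  have "p (0 + 0) \<le> p 0 + p 0" "p ((1/2) *\<^sub>R 0) \<le> (1/2) * p 0"
    using assms unfolding sublinear_def by (blast, metis half_gt_zero_iff zero_less_one)
  then show ?thesis by simp
qed

lemma sublinear_scale:
  assumes "sublinear p" "t \<ge> 0" shows "p (t *\<^sub>R x) = t * p x"
proof (cases "t = 0")
  case False
  with assms have t: "t > 0" by simp
  have "p ((1/t) *\<^sub>R (t *\<^sub>R x)) \<le> (1/t) * p (t *\<^sub>R x)"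
    using assms(1) t unfolding sublinear_def by (meson zero_less_divide_1_iff)
  then have "t * p x \<le> p (t *\<^sub>R x)" using t by (simp add: field_simps)
  moreover have "p (t *\<^sub>R x) \<le> t * p x"
    using assms(1) t unfolding sublinear_def by blast
  ultimately show ?thesis by simp
qed (simp add: sublinear_zero assms)

text \<open>The auxiliary functional of the Hahn-Banach argument: \<open>t = 0\<close> puts it below
  \<open>p\<close>, and \<open>t = 1\<close> at the point \<open>- z\<close> forces a value of at
  most \<open>- p z\<close>.\<close>

definition sublinear_shift :: "('a::real_normed_vector \<Rightarrow> real) \<Rightarrow> 'a \<Rightarrow> 'a \<Rightarrow> real" where
  "sublinear_shift p z y = (INF t\<in>{0..}. p (y + t *\<^sub>R z) - t * p z)"

lemma sublinear_shift_le:
  assumes "sublinear p" "t \<ge> 0"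
  shows "sublinear_shift p z y \<le> p (y + t *\<^sub>R z) - t * p z"
  unfolding sublinear_shift_def
proof (rule cINF_lower)
  \<comment> \<open>Subadditivity against \<open>- y\<close> gives a lower bound independent of
    \<open>s\<close>, so the infimum is taken over a set bounded below.\<close>
  have "- p (- y) \<le> p (y + s *\<^sub>R z) - s * p z" if "s \<ge> 0" for s
  proof -
    have "p ((y + s *\<^sub>R z) + (- y)) \<le> p (y + s *\<^sub>R z) + p (- y)"
      using assms(1) unfolding sublinear_def by blast
    then show ?thesis using sublinear_scale[OF assms(1) that, of z] by simp
  qed
  then show "bdd_below ((\<lambda>t. p (y + t *\<^sub>R z) - t * p z) ` {0..})"
    by (intro bdd_belowI2[where m="- p (- y)"]) auto
qed (use assms in auto)

lemma sublinear_shift: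
  fixes p :: "'a::real_normed_vector \<Rightarrow> real"
  assumes "sublinear p"
  shows "sublinear (sublinear_shift p z)"
  unfolding sublinear_def
proof (intro conjI allI impI)
  fix x y
  \<comment> \<open>The parameters \<open>s\<close> for \<open>x\<close> and \<open>t\<close> for
    \<open>y\<close> add up to a parameter for \<open>x + y\<close>; the two infima are then taken
    one after the other.\<close>
  have le: "sublinear_shift p z (x + y) - (p (x + s *\<^sub>R z) - s * p z) \<le> p (y + t *\<^sub>R z) - t * p z"
    if "s \<ge> 0" "t \<ge> 0" for s t
  proof -
    have "p ((x + s *\<^sub>R z) + (y + t *\<^sub>R z)) \<le> p (x + s *\<^sub>R z) + p (y + t *\<^sub>R z)"
      using assms unfolding sublinear_def by blast
    moreover have "(x + s *\<^sub>R z) + (y + t *\<^sub>R z) = (x + y) + (s + t) *\<^sub>R z"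
      by (simp add: algebra_simps)
    ultimately show ?thesis
      using sublinear_shift_le[OF assms, of "s + t" z "x + y"] that by (simp add: algebra_simps)
  qed
  have "sublinear_shift p z (x + y) - (p (x + s *\<^sub>R z) - s * p z) \<le> sublinear_shift p z y"
    if "s \<ge> 0" for s
    unfolding sublinear_shift_def[of p z y] using le that by (intro cINF_greatest) auto
  then have "sublinear_shift p z (x + y) - sublinear_shift p z y \<le> p (x + s *\<^sub>R z) - s * p z"
    if "s \<ge> 0" for s using that by (simp add: algebra_simps)
  then have "sublinear_shift p z (x + y) - sublinear_shift p z y \<le> sublinear_shift p z x"
    unfolding sublinear_shift_def[of p z x] by (intro cINF_greatest) auto
  then show "sublinear_shift p z (x + y) \<le> sublinear_shift p z x + sublinear_shift p z y" by simp
next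
  fix t :: real and x :: 'a assume t: "t > 0"
  have "sublinear_shift p z (t *\<^sub>R x) / t \<le> p (x + s *\<^sub>R z) - s * p z" if "s \<ge> 0" for s
  proof -
    have "sublinear_shift p z (t *\<^sub>R x) \<le> p (t *\<^sub>R x + (t * s) *\<^sub>R z) - (t * s) * p z"
      using t that by (intro sublinear_shift_le assms) auto
    also have "t *\<^sub>R x + (t * s) *\<^sub>R z = t *\<^sub>R (x + s *\<^sub>R z)" by (simp add: algebra_simps)
    also have "p \<dots> = t * p (x + s *\<^sub>R z)" using t assms by (simp add: sublinear_scale)
    finally show ?thesis using t by (simp add: field_simps)
  qed
  then have "sublinear_shift p z (t *\<^sub>R x) / t \<le> sublinear_shift p z x"
    unfolding sublinear_shift_def[of p z x] by (intro cINF_greatest) auto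
  then show "sublinear_shift p z (t *\<^sub>R x) \<le> t * sublinear_shift p z x"
    using t by (simp add: field_simps)
qed

text \<open>Since \<open>p y + p (- y)\<close> is nonnegative, an upper bound on \<open>p\<close>
  also bounds it from below. This keeps pointwise infima finite.\<close>

lemma sublinear_lower_bound:
  assumes "sublinear p" "p \<le> q"
  shows "- q (- y) \<le> p y"
proof -
  have "p (y + (- y)) \<le> p y + p (- y)" using assms(1) unfolding sublinear_def by blast
  then have "- p (- y) \<le> p y" using sublinear_zero[OF assms(1)] by simp
  moreover have "p (- y) \<le> q (- y)" using assms(2) by (simp add: le_fun_def)
  ultimately show ?thesis by simp
qed

text \<open>Supplies the bound of a chain in Zorn's lemma. Subadditivity of the infimum rests on the
  chain property: two members of \<open>C\<close> can be replaced by the smaller one.\<close>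

lemma sublinear_Inf_chain:
  fixes C :: "('a::real_normed_vector \<Rightarrow> real) set"
  assumes ne: "C \<noteq> {}" and C: "\<And>p. p \<in> C \<Longrightarrow> sublinear p \<and> p \<le> q"
    and chain: "\<And>p p'. p \<in> C \<Longrightarrow> p' \<in> C \<Longrightarrow> p \<le> p' \<or> p' \<le> p"
  defines "m \<equiv> \<lambda>y. INF p\<in>C. p y"
  shows "sublinear m" and "\<And>p. p \<in> C \<Longrightarrow> m \<le> p"
proof -
  have m_eq: "m y = (INF p\<in>C. p y)" for y by (simp add: m_def)
  have lower: "m y \<le> p y" if "p \<in> C" for p y
    unfolding m_eq
    by (rule cINF_lower[OF _ that], rule bdd_belowI2[where m="- q (- y)"])
      (use C sublinear_lower_bound in blast)
  then show "\<And>p. p \<in> C \<Longrightarrow> m \<le> p" by (simp add: le_fun_def)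
  show "sublinear m"
    unfolding sublinear_def
  proof (intro conjI allI impI)
    fix x y
    have le: "m (x + y) - p x \<le> p' y" if pp: "p \<in> C" "p' \<in> C" for p p'
    proof -
      obtain r where r: "r \<in> C" "r \<le> p" "r \<le> p'"
        using chain[OF pp] pp by auto
      have "m (x + y) \<le> r (x + y)" using lower r by blast
      also have "\<dots> \<le> r x + r y" using C r unfolding sublinear_def by blast
      also have "\<dots> \<le> p x + p' y" using r by (intro add_mono) (auto simp: le_fun_def)
      finally show ?thesis by simp
    qed
    have le_m: "m (x + y) - p x \<le> m y" if "p \<in> C" for p
      using le[OF that] ne unfolding m_eq[of y] by (intro cINF_greatest) auto
    have "m (x + y) - m y \<le> p x" if "p \<in> C" for p using le_m[OF that] by simp
    then have "m (x + y) - m y \<le> m x"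
      using ne unfolding m_eq[of x] by (intro cINF_greatest) auto
    then show "m (x + y) \<le> m x + m y" by simp
  next
    fix t :: real and x :: 'a assume t: "t > 0"
    have "m (t *\<^sub>R x) / t \<le> p x" if "p \<in> C" for p
    proof -
      have "m (t *\<^sub>R x) \<le> p (t *\<^sub>R x)" using lower that by blast
      also have "\<dots> \<le> t * p x" using C that t unfolding sublinear_def by blast
      finally show ?thesis using t by (simp add: field_simps)
    qed
    then have "m (t *\<^sub>R x) / t \<le> m x" 
      using ne unfolding m_eq[of x] by (intro cINF_greatest) auto
    then show "m (t *\<^sub>R x) \<le> t * m x" using t by (simp add: field_simps)
  qed
qed

text \<open>A minimal sublinear functional \<open>p\<close> equals each of its shifts, whence \<open>p (- z) = - p z\<close>.\<close>
lemma linear_below_sublinear: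
  fixes q :: "'a::real_normed_vector \<Rightarrow> real"
  assumes "sublinear q"
  shows "\<exists>p. linear p \<and> p \<le> q"
proof -
  let ?S = "{p. sublinear p \<and> p \<le> q}"
  \<comment> \<open>The order is reversed, because Zorn's lemma yields maximal elements and a
    minimal functional is wanted.\<close>
  let ?P = "\<lambda>f g. g \<le> (f :: 'a \<Rightarrow> real)"
  have "\<exists>m\<in>?S. \<forall>a\<in>?S. ?P m a \<longrightarrow> a = m"
  proof (rule predicate_Zorn)
    show "partial_order_on ?S (relation_of ?P ?S)"
      unfolding partial_order_on_def preorder_on_def refl_on_def trans_def antisym_def relation_of_def
      by (auto intro: order_trans)
  next
    fix C assume C: "C \<in> Chains (relation_of ?P ?S)"
    show "\<exists>u\<in>?S. \<forall>a\<in>C. ?P a u"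
    proof (cases "C = {}")
      case True
      then show ?thesis using assms by auto
    next
      case False
      have CS: "\<And>p. p \<in> C \<Longrightarrow> sublinear p \<and> p \<le> q"
        using C unfolding Chains_def relation_of_def by blast
      have chain: "\<And>p p'. p \<in> C \<Longrightarrow> p' \<in> C \<Longrightarrow> p \<le> p' \<or> p' \<le> p"
        using C unfolding Chains_def relation_of_def by blast
      note m = sublinear_Inf_chain[OF False CS chain, simplified]
      obtain p where "p \<in> C" using False by blast
      then have "(\<lambda>y. INF p\<in>C. p y) \<le> q" using m(2) CS by (meson order_trans)
      then show ?thesis using m by blast
    qed
  qed
  then obtain p where p: "sublinear p" "p \<le> q"
    and min: "\<And>a. sublinear a \<Longrightarrow> a \<le> p \<Longrightarrow> a = p"
    by (metis (mono_tags, lifting) mem_Collect_eq order_trans)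
  have odd: "p (- z) = - p z" for z
  proof -
    have "sublinear_shift p z \<le> p"
      using sublinear_shift_le[OF p(1), of 0 z] by (simp add: le_fun_def)
    then have eq: "sublinear_shift p z = p" using min sublinear_shift[OF p(1)] by blast
    have "p (- z) \<le> - p z"
      using sublinear_shift_le[OF p(1), of 1 z "- z"] sublinear_zero[OF p(1)] unfolding eq by simp
    moreover have "- p z \<le> p (- z)" using sublinear_lower_bound[OF p(1) order_refl, of "- z"] by simp
    ultimately show ?thesis by simp
  qed
  have "linear p"
  proof (rule linearI)
    fix x y
    have "p ((x + y) + (- y)) \<le> p (x + y) + p (- y)" "p (x + y) \<le> p x + p y"
      using p(1) unfolding sublinear_def by blast+
    then show "p (x + y) = p x + p y" using odd[of y] by simp
  next
    fix t :: real and x :: 'a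
    show "p (t *\<^sub>R x) = t *\<^sub>R p x"
    proof (cases "t \<ge> 0")
      case True then show ?thesis using sublinear_scale[OF p(1)] by simp
    next
      case False
      then have "p ((- t) *\<^sub>R x) = (- t) * p x" using sublinear_scale[OF p(1), of "- t"] by simp
      then show ?thesis using odd[of "t *\<^sub>R x"] by simp
    qed
  qed
  then show ?thesis using p by blast
qed

text \<open>A linear functional below the shift of the norm along \<open>x\<close> is dominated by
  the norm and has value at most \<open>- norm x\<close> at \<open>- x\<close>; linearity turns this
  into \<open>norm x\<close> at \<open>x\<close>.\<close>

lemma norming_functional:
  fixes x :: "'a::real_normed_vector"
  shows "\<exists>f :: 'a \<Rightarrow>\<^sub>L real. blinfun_apply f x = norm x \<and> norm f \<le> 1"
proof -
  have sn: "sublinear (norm :: 'a \<Rightarrow> real)"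
    unfolding sublinear_def by (auto intro: norm_triangle_ineq)
  obtain p where p: "linear p" "p \<le> sublinear_shift norm x"
    using linear_below_sublinear[OF sublinear_shift[OF sn]] by blast
  have le: "p y \<le> norm (y + t *\<^sub>R x) - t * norm x" if "t \<ge> 0" for y t
    using p(2) sublinear_shift_le[OF sn that, of x y] unfolding le_fun_def by (meson order_trans)
  have len: "p y \<le> norm y" for y using le[of 0 y] by simp
  have neg: "p (- y) = - p y" for y using p(1) by (simp add: linear_neg)
  have "norm (p y) \<le> norm y * 1" for y using len[of y] len[of "- y"] neg[of y] by auto
  then have bl: "bounded_linear p"
    using p(1) by (intro bounded_linear_intro[where K=1]) (auto simp: linear_add linear_scale)
  have "p x = norm x" using le[of 1 "- x"] len[of x] neg[of x] by simp
  moreover have "norm (Blinfun p) \<le> 1"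
    using \<open>\<And>y. norm (p y) \<le> norm y * 1\<close> bl
    by (intro norm_blinfun_bound) (auto simp: bounded_linear_Blinfun_apply)
  ultimately show ?thesis using bl by (metis bounded_linear_Blinfun_apply)
qed

lemma duality_set_nonempty: "duality_set (x :: 'a::real_normed_vector) \<noteq> {}"
proof -
  obtain f :: "'a \<Rightarrow>\<^sub>L real" where f: "blinfun_apply f x = norm x" "norm f \<le> 1"
    using norming_functional by blast
  let ?g = "norm x *\<^sub>R f"
  have gx: "blinfun_apply ?g x = (norm x)\<^sup>2"
    using f by (simp add: power2_eq_square blinfun.scaleR_left)
  have "norm ?g = norm x"
  proof (cases "x = 0")
    case False
    have "norm x \<le> norm f * norm x" using norm_blinfun[of f x] f(1) by simp
    then have "norm f = 1" using False f(2) by simp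
    then show ?thesis by simp
  qed simp
  then show ?thesis using gx unfolding duality_set_def by auto
qed

section \<open>Uniform convexity\<close>

lemma modulus_of_convexity_le:
  fixes u w :: "'a::real_normed_vector"
  assumes "norm u = 1" "norm w = 1" "e \<le> norm (u - w)"
    and "ereal d \<le> modulus_of_convexity TYPE('a) e"
  shows "norm ((u + w) /\<^sub>R 2) \<le> 1 - d"
proof -
  have "modulus_of_convexity TYPE('a) e \<le> ereal (1 - norm ((u + w) /\<^sub>R 2))"
    unfolding modulus_of_convexity_def using assms(1-3) by (intro Inf_lower) blast
  then have "ereal d \<le> ereal (1 - norm ((u + w) /\<^sub>R 2))" using assms(4) by (rule order_trans[rotated])
  then show ?thesis by simp
qed

text \<open>Splitting \<open>a = \<alpha> u\<close>, \<open>b = \<beta> w\<close> with unit vectors \<open>u\<close>, \<open>w\<close> and writing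
  \<open>a + b = \<beta> (u + w) + (\<alpha> - \<beta>) u\<close> reduces a convexity gap to one on the unit sphere.\<close>
lemma midpoint_gap_scaled:
  fixes u w :: "'a::real_normed_vector"
  assumes u: "norm u = 1" and w: "norm w = 1" and b: "0 \<le> \<beta>" "\<beta> \<le> \<alpha>"
    and d: "norm ((u + w) /\<^sub>R 2) \<le> 1 - \<delta>" "0 \<le> \<delta>"
  shows "(norm ((\<alpha> *\<^sub>R u + \<beta> *\<^sub>R w) /\<^sub>R 2))\<^sup>2
    \<le> (\<alpha>\<^sup>2 + \<beta>\<^sup>2) / 2 - (\<alpha> - \<beta>)\<^sup>2 / 4 - \<beta>\<^sup>2 * \<delta>"
proof -
  let ?M = "norm ((\<alpha> *\<^sub>R u + \<beta> *\<^sub>R w) /\<^sub>R 2)"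
  let ?s = "(\<alpha> + \<beta>) / 2"
  have "(\<alpha> *\<^sub>R u + \<beta> *\<^sub>R w) /\<^sub>R 2 = \<beta> *\<^sub>R ((u + w) /\<^sub>R 2) + ((\<alpha> - \<beta>) / 2) *\<^sub>R u"
    by (simp add: algebra_simps flip: scaleR_add_left) (simp add: field_simps)
  then have "?M \<le> norm (\<beta> *\<^sub>R ((u + w) /\<^sub>R 2)) + norm (((\<alpha> - \<beta>) / 2) *\<^sub>R u)"
    by (metis norm_triangle_ineq)
  also have "\<dots> = \<beta> * norm ((u + w) /\<^sub>R 2) + (\<alpha> - \<beta>) / 2"
    using b u by (simp del: scaleR_add_right)
  also have "\<dots> \<le> \<beta> * (1 - \<delta>) + (\<alpha> - \<beta>) / 2" using mult_left_mono[OF d(1) b(1)] by simp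
  finally have M: "?M \<le> ?s - \<beta> * \<delta>" by (simp add: field_simps)
  have bd: "0 \<le> \<beta> * \<delta>" using b d by simp
  have s0: "0 \<le> ?s - \<beta> * \<delta>" by (rule order_trans[OF norm_ge_zero M])
  \<comment> \<open>Bounding one factor by \<open>?s\<close> and then using
    \<open>\<beta> \<le> ?s\<close> keeps the full loss \<open>\<beta>\<^sup>2 * \<delta>\<close>,
    while \<open>?s * ?s\<close> is the mean of the squares minus the radial term.\<close>
  have "?M\<^sup>2 \<le> (?s - \<beta> * \<delta>) * (?s - \<beta> * \<delta>)"
    unfolding power2_eq_square by (intro mult_mono M s0) simp
  also have "\<dots> \<le> ?s * (?s - \<beta> * \<delta>)"
    using bd by (intro mult_right_mono s0) linarith
  also have "\<dots> = ?s * ?s - ?s * (\<beta> * \<delta>)" by (simp add: algebra_simps)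
  also have "\<dots> \<le> ?s * ?s - \<beta> * (\<beta> * \<delta>)"
    using b mult_right_mono[OF _ bd, of \<beta> ?s] by simp
  also have "\<dots> = (\<alpha>\<^sup>2 + \<beta>\<^sup>2) / 2 - (\<alpha> - \<beta>)\<^sup>2 / 4 - \<beta>\<^sup>2 * \<delta>"
    by (simp add: power2_eq_square field_simps)
  finally show ?thesis .
qed

lemma polar_decomposition:
  fixes a b :: "'a::real_normed_vector"
  assumes "a \<noteq> 0"
  obtains u w where "norm u = 1" "norm w = 1" "a = norm a *\<^sub>R u" "b = norm b *\<^sub>R w"
proof (cases "b = 0")
  case True
  show ?thesis by (rule that[of "sgn a" "sgn a"]) (use True assms in \<open>auto simp: norm_sgn sgn_div_norm\<close>)
next
  case False
  show ?thesis by (rule that[of "sgn a" "sgn b"]) (use False assms in \<open>auto simp: norm_sgn sgn_div_norm\<close>)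
qed

text \<open>The difference \<open>a - b\<close> has an angular part, controlled by the modulus of
  convexity, and a radial part, controlled by the scalar term in
  \<open>midpoint_gap_scaled\<close>.\<close>

lemma midpoint_gap_quadratic:
  assumes "two_uniformly_convex_space TYPE('a::real_normed_vector)"
  obtains c where "c > 0"
    "\<And>a b :: 'a. (norm ((a + b) /\<^sub>R 2))\<^sup>2 \<le> ((norm a)\<^sup>2 + (norm b)\<^sup>2) / 2 - c * (norm (a - b))\<^sup>2"
proof -
  obtain c where c: "c > 0"
    and mod: "\<And>e. 0 < e \<Longrightarrow> e \<le> 2 \<Longrightarrow> ereal (c * e\<^sup>2) \<le> modulus_of_convexity TYPE('a) e"
    using assms unfolding two_uniformly_convex_space_def by blast
  \<comment> \<open>The minimum matches the coefficients 1/4 of the radial and \<open>c\<close> of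
    the angular gap; the factor 1/2 absorbs the 2 lost in squaring a sum.\<close>
  define c' where "c' = min (1/4) c / 2"
  have c': "c' > 0" using c by (simp add: c'_def)
  have ordered: "(norm ((a + b) /\<^sub>R 2))\<^sup>2 \<le> ((norm a)\<^sup>2 + (norm b)\<^sup>2) / 2 - c' * (norm (a - b))\<^sup>2"
    if le: "norm b \<le> norm a" for a b :: 'a
  proof (cases "a = 0")
    case False
    then obtain u w where uw: "norm u = 1" "norm w = 1" and a: "a = norm a *\<^sub>R u" and b: "b = norm b *\<^sub>R w"
      by (rule polar_decomposition[of a b])
    let ?\<alpha> = "norm a" and ?\<beta> = "norm b" and ?d = "norm (u - w)"
    have d2: "?d \<le> 2" using norm_triangle_ineq4[of u w] uw by simp
    have "norm ((u + w) /\<^sub>R 2) \<le> 1 - c * ?d\<^sup>2"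
    \<comment> \<open>The modulus bound covers only positive separations, so equal directions are
      treated apart.\<close>
    proof (cases "?d = 0")
      case True then show ?thesis using uw by (simp flip: scaleR_2)
    next
      case False
      then show ?thesis using modulus_of_convexity_le[OF uw order_refl mod] d2 by simp
    qed
    note gap = midpoint_gap_scaled[OF uw _ le this]
    have "a - b = ?\<beta> *\<^sub>R (u - w) + (?\<alpha> - ?\<beta>) *\<^sub>R u"
      by (subst a, subst b) (simp add: algebra_simps)
    then have "norm (a - b) \<le> ?\<beta> * ?d + (?\<alpha> - ?\<beta>)"
      using norm_triangle_ineq[of "?\<beta> *\<^sub>R (u - w)" "(?\<alpha> - ?\<beta>) *\<^sub>R u"] uw le by simp
    then have "(norm (a - b))\<^sup>2 \<le> (?\<beta> * ?d + (?\<alpha> - ?\<beta>))\<^sup>2" by (simp add: power_mono)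
    also have "\<dots> \<le> 2 * (?\<beta> * ?d)\<^sup>2 + 2 * (?\<alpha> - ?\<beta>)\<^sup>2"
      using sum_squares_bound[of "?\<beta> * ?d" "?\<alpha> - ?\<beta>"] by (simp add: power2_sum)
    finally have "c' * (norm (a - b))\<^sup>2 \<le> c' * (2 * (?\<beta> * ?d)\<^sup>2 + 2 * (?\<alpha> - ?\<beta>)\<^sup>2)"
      using c' by (simp add: mult_left_mono)
    also have "\<dots> = (2 * c') * (?\<beta> * ?d)\<^sup>2 + (2 * c') * (?\<alpha> - ?\<beta>)\<^sup>2" by (simp add: algebra_simps)
    also have "\<dots> \<le> c * (?\<beta> * ?d)\<^sup>2 + (1/4) * (?\<alpha> - ?\<beta>)\<^sup>2"
      by (intro add_mono mult_right_mono) (auto simp: c'_def)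
    finally show ?thesis
      using gap c by (simp add: power_mult_distrib a[symmetric] b[symmetric] algebra_simps)
  qed (use le in simp)
  show ?thesis
  proof (rule that[OF c'])
    fix a b :: 'a
    show "(norm ((a + b) /\<^sub>R 2))\<^sup>2 \<le> ((norm a)\<^sup>2 + (norm b)\<^sup>2) / 2 - c' * (norm (a - b))\<^sup>2"
      using ordered[of a b] ordered[of b a]
      by (cases "norm b \<le> norm a") (auto simp: add.commute norm_minus_commute)
  qed
qed

text \<open>A separation \<open>r\<close> is either radial by at least \<open>r / 2\<close>, or
  angular; in the second case the shorter vector has length at least \<open>r / 4\<close>, so the
  gap on the unit sphere survives scaling.\<close>

lemma midpoint_gap_uniform:
  assumes "uniformly_convex_space TYPE('a::real_normed_vector)" and r: "r > 0"
  obtains \<eta> where "\<eta> > 0"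
    "\<And>a b :: 'a. norm a \<le> R \<Longrightarrow> norm b \<le> R \<Longrightarrow> r \<le> norm (a - b) \<Longrightarrow>
      (norm ((a + b) /\<^sub>R 2))\<^sup>2 \<le> ((norm a)\<^sup>2 + (norm b)\<^sup>2) / 2 - \<eta>"
proof (cases "R > 0")
  case R: True
  \<comment> \<open>\<open>r / (2 * R)\<close> is the least angle left when the radial difference is
    below \<open>r / 2\<close>; the cap 2 keeps \<open>e\<close> in the range of the
    hypothesis.\<close>
  define e where "e = min 2 (r / (2 * R))"
  have e: "0 < e" "e \<le> 2" using r R by (auto simp: e_def)
  then have "0 < modulus_of_convexity TYPE('a) e"
    using assms unfolding uniformly_convex_space_def by blast
  \<comment> \<open>The modulus is an extended real and may be infinite, so a positive real below it
    is chosen.\<close>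
  then obtain \<delta> where "0 < ereal \<delta>" and \<delta>: "ereal \<delta> \<le> modulus_of_convexity TYPE('a) e"
    using ereal_dense2 less_imp_le by (metis)
  then have \<delta>0: "\<delta> > 0" by simp
  \<comment> \<open>The smaller of the radial gap \<open>(r / 2)\<^sup>2 / 4\<close> and the angular
    gap with \<beta> at its least value \<open>r / 4\<close>.\<close>
  define \<eta> where "\<eta> = min (r\<^sup>2 / 16) ((r / 4)\<^sup>2 * \<delta>)"
  have \<eta>: "\<eta> > 0" using r \<delta>0 by (simp add: \<eta>_def)
  have ordered: "(norm ((a + b) /\<^sub>R 2))\<^sup>2 \<le> ((norm a)\<^sup>2 + (norm b)\<^sup>2) / 2 - \<eta>"
    if le: "norm b \<le> norm a" and aR: "norm a \<le> R" and rd: "r \<le> norm (a - b)" for a b :: 'a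
  proof -
    have "a \<noteq> 0" using le rd r by auto
    then obtain u w where uw: "norm u = 1" "norm w = 1" and a: "a = norm a *\<^sub>R u" and b: "b = norm b *\<^sub>R w"
      by (rule polar_decomposition[of a b])
    let ?\<alpha> = "norm a" and ?\<beta> = "norm b" and ?d = "norm (u - w)"
    have d2: "?d \<le> 2" using norm_triangle_ineq4[of u w] uw by simp
    have "a - b = ?\<beta> *\<^sub>R (u - w) + (?\<alpha> - ?\<beta>) *\<^sub>R u"
      by (subst a, subst b) (simp add: algebra_simps)
    then have tri: "norm (a - b) \<le> ?\<beta> * ?d + (?\<alpha> - ?\<beta>)"
      using norm_triangle_ineq[of "?\<beta> *\<^sub>R (u - w)" "(?\<alpha> - ?\<beta>) *\<^sub>R u"] uw le by simp
    show ?thesis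
    proof (cases "r / 2 \<le> ?\<alpha> - ?\<beta>")
      case True
      have "norm ((u + w) /\<^sub>R 2) \<le> 1 - 0" using norm_triangle_ineq[of u w] uw by simp
      note gap = midpoint_gap_scaled[OF uw _ le this]
      have "(r / 2)\<^sup>2 \<le> (?\<alpha> - ?\<beta>)\<^sup>2" using True r by (intro power_mono) auto
      then have "\<eta> \<le> (?\<alpha> - ?\<beta>)\<^sup>2 / 4" by (simp add: \<eta>_def power_divide)
      then show ?thesis using gap by (simp add: a[symmetric] b[symmetric])
    next
      case False
      then have bd: "r / 2 \<le> ?\<beta> * ?d" using tri rd by simp
      also have "\<dots> \<le> ?\<beta> * 2" using d2 by (intro mult_left_mono) auto
      finally have \<beta>: "r / 4 \<le> ?\<beta>" by simp
      have "r / 2 \<le> R * ?d" using bd le aR by (meson mult_right_mono norm_ge_zero order_trans)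
      then have "r / (2 * R) \<le> ?d" using R by (simp add: field_simps)
      then have "e \<le> ?d" by (simp add: e_def)
      then have "norm ((u + w) /\<^sub>R 2) \<le> 1 - \<delta>" by (rule modulus_of_convexity_le[OF uw _ \<delta>])
      note gap = midpoint_gap_scaled[OF uw _ le this]
      have "\<eta> \<le> (r / 4)\<^sup>2 * \<delta>" by (simp add: \<eta>_def)
      also have "\<dots> \<le> ?\<beta>\<^sup>2 * \<delta>" using \<beta> r \<delta>0 by (intro mult_right_mono power_mono) auto
      finally have "\<eta> \<le> ?\<beta>\<^sup>2 * \<delta>" .
      moreover have "(norm ((a + b) /\<^sub>R 2))\<^sup>2
          \<le> (?\<alpha>\<^sup>2 + ?\<beta>\<^sup>2) / 2 - (?\<alpha> - ?\<beta>)\<^sup>2 / 4 - ?\<beta>\<^sup>2 * \<delta>"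
        using gap \<delta>0 by (simp add: a[symmetric] b[symmetric])
      ultimately show ?thesis using zero_le_power2[of "?\<alpha> - ?\<beta>"] by linarith
    qed
  qed
  show ?thesis
  proof (rule that[OF \<eta>])
    fix a b :: 'a
    assume "norm a \<le> R" "norm b \<le> R" "r \<le> norm (a - b)"
    then show "(norm ((a + b) /\<^sub>R 2))\<^sup>2 \<le> ((norm a)\<^sup>2 + (norm b)\<^sup>2) / 2 - \<eta>"
      using ordered[of a b] ordered[of b a]
      by (cases "norm b \<le> norm a") (auto simp: add.commute norm_minus_commute)
  qed
next
  \<comment> \<open>For \<open>R \<le> 0\<close> no two admissible points are \<open>r\<close>
    apart, so any positive gap will do.\<close>
  case False
  show ?thesis
  proof (rule that[of 1])
    fix a b :: 'a
    assume "norm a \<le> R" "norm b \<le> R" "r \<le> norm (a - b)"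
    then have "norm (a - b) \<le> 0" using norm_triangle_ineq4[of a b] False by linarith
    then show "(norm ((a + b) /\<^sub>R 2))\<^sup>2 \<le> ((norm a)\<^sup>2 + (norm b)\<^sup>2) / 2 - 1"
      using r \<open>r \<le> norm (a - b)\<close> by linarith
  qed simp
qed

section \<open>The duality map\<close>

abbreviation duality_pairing :: "'a::real_normed_vector \<Rightarrow> 'a \<Rightarrow> real" where
  "duality_pairing u v \<equiv> blinfun_apply (duality_map u) v"

text \<open>The midpoint of two elements still pairs with \<open>x\<close> to
  \<open>(norm x)\<^sup>2\<close>, so its norm is at least \<open>norm x\<close>; the convexity gap
  in the dual then leaves no room for \<open>f - g\<close>.\<close>

lemma duality_set_singleton:
  fixes x :: "'a::real_normed_vector"
  assumes "two_uniformly_convex_space TYPE('a \<Rightarrow>\<^sub>L real)"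
    and f: "f \<in> duality_set x" and g: "g \<in> duality_set x"
  shows "f = g"
proof -
  obtain c where c: "c > 0" and
    gap: "\<And>a b :: 'a \<Rightarrow>\<^sub>L real. (norm ((a + b) /\<^sub>R 2))\<^sup>2 \<le> ((norm a)\<^sup>2 + (norm b)\<^sup>2) / 2 - c * (norm (a - b))\<^sup>2"
    by (rule midpoint_gap_quadratic[OF assms(1)]) (rule that)
  have nf: "norm f = norm x" "norm g = norm x" using f g by (auto simp: duality_set_def)
  have "norm x * norm x = blinfun_apply ((f + g) /\<^sub>R 2) x"
    using f g by (simp add: duality_set_def blinfun.add_left blinfun.scaleR_left power2_eq_square)
  also have "\<dots> \<le> norm ((f + g) /\<^sub>R 2) * norm x"
    using norm_blinfun[of "(f + g) /\<^sub>R 2" x] by simp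
  finally have "norm x \<le> norm ((f + g) /\<^sub>R 2)" by (cases "x = 0") auto
  then have "(norm x)\<^sup>2 \<le> (norm ((f + g) /\<^sub>R 2))\<^sup>2" by (intro power_mono) auto
  then have "c * (norm (f - g))\<^sup>2 \<le> 0" using gap[of f g] unfolding nf by argo
  then show ?thesis using c by (simp add: mult_le_0_iff)
qed

context
  assumes dual_2uc: "two_uniformly_convex_space TYPE('a::real_normed_vector \<Rightarrow>\<^sub>L real)"
begin

lemma duality_map_in: "duality_map x \<in> duality_set (x :: 'a)"
proof -
  obtain f where f: "f \<in> duality_set x" using duality_set_nonempty by blast
  then have "duality_set x = {f}" using duality_set_singleton[OF dual_2uc] by blast
  then show ?thesis by (simp add: duality_map_def)
qed

lemma duality_pairing_self: "duality_pairing x (x :: 'a) = (norm x)\<^sup>2"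
  using duality_map_in[of x] by (simp add: duality_set_def)

lemma norm_duality_map: "norm (duality_map (x :: 'a)) = norm x"
  using duality_map_in[of x] by (simp add: duality_set_def)

lemma duality_map_zero: "duality_map (0 :: 'a) = 0"
  using norm_duality_map[of 0] by simp

lemma duality_pairing_le: "duality_pairing u v \<le> norm u * norm (v :: 'a)"
  using norm_blinfun[of "duality_map u" v] by (simp add: norm_duality_map)

text \<open>\<open>duality_map u\<close> is a subgradient of half the squared norm, by the bound on
  the pairing and \<open>2rs \<le> r^2 + s^2\<close>.\<close>

lemma duality_pairing_subgradient:
  "(norm (u :: 'a))\<^sup>2 + 2 * duality_pairing u (w - u) \<le> (norm w)\<^sup>2"
proof -
  have "2 * duality_pairing u w \<le> 2 * (norm u * norm w)" using duality_pairing_le[of u w] by simp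
  also have "\<dots> \<le> (norm u)\<^sup>2 + (norm w)\<^sup>2" using sum_squares_bound[of "norm u" "norm w"] by simp
  finally show ?thesis by (simp add: blinfun.diff_right duality_pairing_self)
qed

text \<open>Young's inequality for the midpoint functional, tested at \<open>u\<close> and
  \<open>w\<close>, bounds the cross pairings by \<open>?M\<^sup>2\<close>. With the quadratic gap
  in the dual this makes the duality map cocoercive, hence Lipschitz.\<close>

lemma duality_map_Lipschitz:
  obtains L where "L > 0" "\<And>u w :: 'a. norm (duality_map u - duality_map w) \<le> L * norm (u - w)"
proof -
  obtain c where c: "c > 0" and
    gap: "\<And>a b :: 'a \<Rightarrow>\<^sub>L real. (norm ((a + b) /\<^sub>R 2))\<^sup>2 \<le> ((norm a)\<^sup>2 + (norm b)\<^sup>2) / 2 - c * (norm (a - b))\<^sup>2"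
    by (rule midpoint_gap_quadratic[OF dual_2uc]) (rule that)
  have "norm (duality_map u - duality_map w) \<le> (1 / (2 * c)) * norm (u - w)" for u w :: 'a
  proof -
    let ?f = "duality_map u" and ?g = "duality_map w"
    let ?M = "norm ((?f + ?g) /\<^sub>R 2)"
    have bound: "2 * blinfun_apply ((?f + ?g) /\<^sub>R 2) v \<le> (norm v)\<^sup>2 + ?M\<^sup>2" for v :: 'a
      using norm_blinfun[of "(?f + ?g) /\<^sub>R 2" v] sum_squares_bound[of ?M "norm v"] by simp
    have "blinfun_apply ?g u \<le> ?M\<^sup>2" "blinfun_apply ?f w \<le> ?M\<^sup>2"
      using bound[of u] bound[of w]
      by (simp_all add: blinfun.add_left blinfun.scaleR_left duality_pairing_self)
    then have "2 * c * (norm (?f - ?g))\<^sup>2 \<le> blinfun_apply (?f - ?g) (u - w)"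
      using gap[of ?f ?g] unfolding norm_duality_map blinfun.diff_left blinfun.diff_right
        duality_pairing_self by argo
    also have "\<dots> \<le> norm (?f - ?g) * norm (u - w)"
      using norm_blinfun[of "?f - ?g" "u - w"] by simp
    finally have "norm (?f - ?g) * (2 * c * norm (?f - ?g)) \<le> norm (?f - ?g) * norm (u - w)"
      by (simp add: power2_eq_square mult_ac)
    then have "2 * c * norm (?f - ?g) \<le> norm (u - w)"
      by (cases "?f = ?g") (auto simp: mult_le_cancel_left)
    then show ?thesis using c by (simp add: field_simps)
  qed
  then show ?thesis using that[of "1 / (2 * c)"] c by auto
qed

text \<open>The subgradient inequality at \<open>u + v\<close> has
  \<open>duality_map (u + v)\<close> in place of \<open>duality_map u\<close>; exchanging them costs
  \<open>L * (norm v)\<^sup>2\<close>, doubled in \<open>\<kappa> = 2 * L\<close>.\<close>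

lemma norm_sq_smooth:
  obtains \<kappa> where "\<kappa> > 0"
    "\<And>u v :: 'a. (norm (u + v))\<^sup>2 \<le> (norm u)\<^sup>2 + 2 * duality_pairing u v + \<kappa> * (norm v)\<^sup>2"
proof -
  obtain L where L: "L > 0" "\<And>u w :: 'a. norm (duality_map u - duality_map w) \<le> L * norm (u - w)"
    by (rule duality_map_Lipschitz) (rule that)
  have "(norm (u + v))\<^sup>2 \<le> (norm u)\<^sup>2 + 2 * duality_pairing u v + (2 * L) * (norm v)\<^sup>2" for u v :: 'a
  proof -
    let ?e = "duality_map (u + v) - duality_map u"
    have "blinfun_apply ?e v \<le> norm ?e * norm v" using norm_blinfun[of ?e v] by simp
    also have "\<dots> \<le> (L * norm v) * norm v"
      using L(2)[of "u + v" u] by (intro mult_right_mono) auto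
    finally have "blinfun_apply ?e v \<le> L * (norm v)\<^sup>2" by (simp add: power2_eq_square)
    then show ?thesis
      using duality_pairing_subgradient[of "u + v" u] by (simp add: blinfun.diff_left blinfun.minus_right)
  qed
  then show ?thesis using that[of "2 * L"] L(1) by auto
qed

lemma tendsto_duality_map:
  fixes f :: "'b \<Rightarrow> 'a"
  assumes "(f \<longlongrightarrow> l) F"
  shows "((\<lambda>x. duality_map (f x)) \<longlongrightarrow> duality_map l) F"
proof -
  obtain L where L: "L > 0" "\<And>u w :: 'a. norm (duality_map u - duality_map w) \<le> L * norm (u - w)"
    by (rule duality_map_Lipschitz) (rule that)
  have lim: "((\<lambda>x. L * norm (f x - l)) \<longlongrightarrow> 0) F"
    by (rule tendsto_mult_right_zero[OF tendsto_norm_zero[OF LIM_zero[OF assms]]])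
  have "((\<lambda>x. duality_map (f x) - duality_map l) \<longlongrightarrow> 0) F"
    by (rule Lim_null_comparison[OF _ lim]) (use L(2) in auto)
  then show ?thesis by (rule LIM_zero_cancel)
qed

text \<open>Translates metric facts into pairings, both for accretive operators and for nearest
  points: the smoothness inequality is divided by \<open>t\<close>, and \<open>t\<close> tends to
  0.\<close>

lemma duality_pairing_nonneg_of_norm_le:
  fixes u v :: 'a
  assumes "\<And>t. 0 < t \<Longrightarrow> t < 1 \<Longrightarrow> norm u \<le> norm (u + t *\<^sub>R v)"
  shows "0 \<le> duality_pairing u v"
proof -
  obtain \<kappa> where \<kappa>: "\<kappa> > 0"
    "\<And>u v :: 'a. (norm (u + v))\<^sup>2 \<le> (norm u)\<^sup>2 + 2 * duality_pairing u v + \<kappa> * (norm v)\<^sup>2"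
    by (rule norm_sq_smooth) (rule that)
  have le: "0 \<le> 2 * duality_pairing u v + \<kappa> * t * (norm v)\<^sup>2" if t: "0 < t" "t < 1" for t
  proof -
    have "(norm u)\<^sup>2 \<le> (norm (u + t *\<^sub>R v))\<^sup>2" using assms[OF t] by (intro power_mono) auto
    also have "\<dots> \<le> (norm u)\<^sup>2 + t * (2 * duality_pairing u v + \<kappa> * t * (norm v)\<^sup>2)"
      using \<kappa>(2)[of u "t *\<^sub>R v"] t
      by (simp add: blinfun.scaleR_right power_mult_distrib power2_eq_square algebra_simps)
    finally show ?thesis using t by (simp add: zero_le_mult_iff)
  qed
  have "((\<lambda>t. 2 * duality_pairing u v + \<kappa> * t * (norm v)\<^sup>2) \<longlongrightarrow> 2 * duality_pairing u v + \<kappa> * 0 * (norm v)\<^sup>2)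
      (at_right 0)"
    by (intro tendsto_intros)
  moreover have "\<forall>\<^sub>F t in at_right 0. 0 \<le> 2 * duality_pairing u v + \<kappa> * t * (norm v)\<^sup>2"
    using eventually_at_right_real[of 0 "1::real"] le by (auto elim!: eventually_mono)
  ultimately have "0 \<le> 2 * duality_pairing u v + \<kappa> * 0 * (norm v)\<^sup>2"
    by (intro tendsto_lowerbound) auto
  then show ?thesis by simp
qed

lemma accretive_duality_pairing:
  fixes A :: "'a \<Rightarrow> 'a set"
  assumes "accretive A" "u \<in> A x" "v \<in> A y"
  shows "0 \<le> duality_pairing (x - y) (u - v)"
  using assms unfolding accretive_def by (intro duality_pairing_nonneg_of_norm_le) blast

text \<open>Young's inequality at the midpoint of \<open>a\<close> and \<open>b\<close> bounds both
  cross pairings. With \<open>midpoint_gap_uniform\<close> this makes the duality map uniformly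
  monotone on bounded sets.\<close>

lemma duality_map_monotone_gap:
  fixes a b :: 'a
  shows "(norm a)\<^sup>2 + (norm b)\<^sup>2 - 2 * (norm ((a + b) /\<^sub>R 2))\<^sup>2
    \<le> duality_pairing b (b - a) - duality_pairing a (b - a)"
proof -
  let ?M = "norm ((a + b) /\<^sub>R 2)"
  have "2 * duality_pairing v ((a + b) /\<^sub>R 2) \<le> (norm v)\<^sup>2 + ?M\<^sup>2" for v :: 'a
    using duality_pairing_le[of v "(a + b) /\<^sub>R 2"] sum_squares_bound[of ?M "norm v"] by (simp add: mult.commute)
  from this[of a] this[of b] show ?thesis
    by (simp add: blinfun.add_right blinfun.diff_right blinfun.scaleR_right duality_pairing_self)
qed

end

section \<open>Nearest points and closed convex sets\<close>

text \<open>Two almost nearest points that are far apart would have a midpoint in \<open>S\<close>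
  closer to \<open>x\<close> than the distance to \<open>S\<close> allows.\<close>

lemma near_points_close:
  fixes x :: "'a::real_normed_vector"
  assumes uc: "uniformly_convex_space TYPE('a)" and "convex S" and e: "e > 0"
  obtains \<delta> where "\<delta> > 0"
    "\<And>p q. p \<in> S \<Longrightarrow> q \<in> S \<Longrightarrow> norm (x - p) \<le> infdist x S + \<delta> \<Longrightarrow>
      norm (x - q) \<le> infdist x S + \<delta> \<Longrightarrow> norm (p - q) < e"
proof -
  define d where "d = infdist x S"
  have d: "d \<ge> 0" by (simp add: d_def infdist_nonneg)
  obtain \<eta> where \<eta>: "\<eta> > 0" and gap: "\<And>a b :: 'a. norm a \<le> d + 1 \<Longrightarrow> norm b \<le> d + 1 \<Longrightarrow>
      e \<le> norm (a - b) \<Longrightarrow> (norm ((a + b) /\<^sub>R 2))\<^sup>2 \<le> ((norm a)\<^sup>2 + (norm b)\<^sup>2) / 2 - \<eta>"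
    by (rule midpoint_gap_uniform[OF uc e, of "d + 1"]) (rule that)
  \<comment> \<open>Chosen so that \<open>(d + \<delta>)\<^sup>2 < d\<^sup>2 + \<eta>\<close>; the
    bound 1 keeps the points in the ball of radius \<open>d + 1\<close> for which \<eta> was
    obtained.\<close>
  define \<delta> where "\<delta> = min 1 (\<eta> / (2 * d + 2))"
  have \<delta>: "\<delta> > 0" "\<delta> \<le> 1" using \<eta> d by (auto simp: \<delta>_def)
  have "\<delta> \<le> \<eta> / (2 * d + 2)" by (simp add: \<delta>_def)
  then have "\<delta> * (2 * d + 2) \<le> \<eta>" using d by (simp add: pos_le_divide_eq)
  moreover have "\<delta> * \<delta> \<le> \<delta>" using \<delta> by (simp add: mult_left_le)
  moreover have "(d + \<delta>)\<^sup>2 = d\<^sup>2 + \<delta> * (2 * d + 2) - 2 * \<delta> + \<delta> * \<delta>"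
    by (simp add: power2_eq_square algebra_simps)
  ultimately have lt: "(d + \<delta>)\<^sup>2 < d\<^sup>2 + \<eta>" using \<delta> by linarith
  show ?thesis
  proof (rule that[OF \<delta>(1)], rule ccontr)
    fix p q assume pq: "p \<in> S" "q \<in> S" "norm (x - p) \<le> infdist x S + \<delta>" "norm (x - q) \<le> infdist x S + \<delta>"
      and "\<not> norm (p - q) < e"
    then have far: "e \<le> norm ((x - p) - (x - q))" by (simp add: norm_minus_commute)
    have n: "norm (x - p) \<le> d + \<delta>" "norm (x - q) \<le> d + \<delta>" using pq by (auto simp: d_def)
    have "(1/2) *\<^sub>R p + (1/2) *\<^sub>R q \<in> S" using \<open>convex S\<close> pq by (intro convexD) auto
    then have "d \<le> norm (x - ((1/2) *\<^sub>R p + (1/2) *\<^sub>R q))" by (metis d_def infdist_le dist_norm)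
    also have "x - ((1/2) *\<^sub>R p + (1/2) *\<^sub>R q) = ((x - p) + (x - q)) /\<^sub>R 2"
      by (simp add: algebra_simps flip: scaleR_2)
    finally have "d\<^sup>2 \<le> (norm (((x - p) + (x - q)) /\<^sub>R 2))\<^sup>2" using d by (intro power_mono)
    also have "\<dots> \<le> ((norm (x - p))\<^sup>2 + (norm (x - q))\<^sup>2) / 2 - \<eta>"
      using n \<delta>(2) far by (intro gap) auto
    also have "\<dots> \<le> (d + \<delta>)\<^sup>2 - \<eta>"
      using power_mono[OF n(1), of 2] power_mono[OF n(2), of 2] by simp
    finally show False using lt by simp
  qed
qed

lemma Cauchy_minimizing:
  fixes x :: "'a::real_normed_vector"
  assumes uc: "uniformly_convex_space TYPE('a)" and S: "convex S" "\<And>n. q n \<in> S"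
    and lim: "(\<lambda>n. norm (x - q n)) \<longlonglongrightarrow> infdist x S"
  shows "Cauchy q"
proof (rule CauchyI)
  fix e :: real assume e: "e > 0"
  obtain \<delta> where \<delta>: "\<delta> > 0" and close: "\<And>p q. p \<in> S \<Longrightarrow> q \<in> S \<Longrightarrow> norm (x - p) \<le> infdist x S + \<delta> \<Longrightarrow>
      norm (x - q) \<le> infdist x S + \<delta> \<Longrightarrow> norm (p - q) < e"
    by (rule near_points_close[OF uc S(1) e, of x]) (rule that)
  have "\<forall>\<^sub>F n in sequentially. norm (x - q n) < infdist x S + \<delta>"
    using lim \<delta> by (intro order_tendstoD) auto
  then obtain N where "\<And>n. n \<ge> N \<Longrightarrow> norm (x - q n) < infdist x S + \<delta>"
    by (auto simp: eventually_sequentially)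
  then show "\<exists>M. \<forall>m\<ge>M. \<forall>n\<ge>M. norm (q m - q n) < e"
    using close S(2) by (meson less_imp_le)
qed

lemma infdist_minimizing_sequence:
  fixes x :: "'a::real_normed_vector"
  assumes "S \<noteq> {}"
  obtains q where "\<And>n. q n \<in> S" "(\<lambda>n. norm (x - q n)) \<longlonglongrightarrow> infdist x S"
proof -
  have "\<exists>q. q \<in> S \<and> norm (x - q) < infdist x S + 1 / real (Suc n)" for n
  proof (rule ccontr)
    assume "\<not> ?thesis"
    then have "infdist x S + 1 / real (Suc n) \<le> (INF q\<in>S. dist x q)"
      by (intro cINF_greatest assms) (auto simp: not_less dist_norm)
    then show False using infdist_notempty[OF assms, of x] by simp
  qed
  then obtain q where q: "\<And>n. q n \<in> S" "\<And>n. norm (x - q n) < infdist x S + 1 / real (Suc n)"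
    by metis
  have bound: "(\<lambda>n. infdist x S + 1 / real (Suc n)) \<longlonglongrightarrow> infdist x S"
    using tendsto_add[OF tendsto_const[of "infdist x S"] LIMSEQ_Suc[OF lim_1_over_n]] by simp
  have lower: "infdist x S \<le> norm (x - q n)" for n
    using infdist_le[OF q(1)] by (simp add: dist_norm)
  have "(\<lambda>n. norm (x - q n)) \<longlonglongrightarrow> infdist x S"
    using lower q(2)
    by (intro tendsto_sandwich[OF _ _ tendsto_const bound] always_eventually) (auto simp: less_imp_le)
  then show ?thesis using q that by blast
qed

lemma nearest_point_unique:
  fixes x :: "'a::real_normed_vector"
  assumes uc: "uniformly_convex_space TYPE('a)" and S: "convex S"
    and p: "p \<in> S" "norm (x - p) = infdist x S"
  shows "nearest_point S x = p"
  unfolding nearest_point_def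
proof (rule the_equality)
  show "p \<in> S \<and> (\<forall>q\<in>S. norm (x - p) \<le> norm (x - q))"
    using p infdist_le[of _ S x] by (auto simp: dist_norm)
next
  fix p' assume p': "p' \<in> S \<and> (\<forall>q\<in>S. norm (x - p') \<le> norm (x - q))"
  show "p' = p"
  proof (rule ccontr)
    assume "p' \<noteq> p"
    then have e: "norm (p' - p) > 0" by simp
    obtain \<delta> where \<delta>: "\<delta> > 0" and close: "\<And>a b. a \<in> S \<Longrightarrow> b \<in> S \<Longrightarrow> norm (x - a) \<le> infdist x S + \<delta> \<Longrightarrow>
        norm (x - b) \<le> infdist x S + \<delta> \<Longrightarrow> norm (a - b) < norm (p' - p)"
      by (rule near_points_close[OF uc S(1) e, of x]) (rule that)
    have "norm (x - p') \<le> infdist x S + \<delta>" "norm (x - p) \<le> infdist x S + \<delta>"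
      using p p' \<delta> by force+
    then show False using close p p' by blast
  qed
qed

lemma nearest_point:
  fixes x :: "'a::banach"
  assumes uc: "uniformly_convex_space TYPE('a)" and S: "convex S" "closed S" "S \<noteq> {}"
  shows "nearest_point S x \<in> S" and "norm (x - nearest_point S x) = infdist x S"
proof -
  obtain q where q: "\<And>n. q n \<in> S" "(\<lambda>n. norm (x - q n)) \<longlonglongrightarrow> infdist x S"
    by (rule infdist_minimizing_sequence[OF S(3)]) (rule that)
  obtain p where p: "q \<longlonglongrightarrow> p"
    using Cauchy_minimizing[OF uc S(1) q] by (auto simp: Cauchy_convergent_iff convergent_def)
  have pS: "p \<in> S" using closed_sequentially[OF S(2) _ p] q by blast
  have "(\<lambda>n. norm (x - q n)) \<longlonglongrightarrow> norm (x - p)" by (intro tendsto_intros p)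
  then have "norm (x - p) = infdist x S" using q(2) LIMSEQ_unique by blast
  with pS show "nearest_point S x \<in> S" "norm (x - nearest_point S x) = infdist x S"
    using nearest_point_unique[OF uc S(1)] by auto
qed

lemma tendsto_nearest_point:
  fixes x :: "'a::banach"
  assumes uc: "uniformly_convex_space TYPE('a)" and S: "convex S" "closed S" "\<And>n. q n \<in> S"
    and lim: "(\<lambda>n. norm (x - q n)) \<longlonglongrightarrow> infdist x S"
  shows "q \<longlonglongrightarrow> nearest_point S x"
proof -
  obtain p where p: "q \<longlonglongrightarrow> p"
    using Cauchy_minimizing[OF uc S(1,3) lim] by (auto simp: Cauchy_convergent_iff convergent_def)
  have pS: "p \<in> S" using closed_sequentially[OF S(2) _ p] S by blast
  have "(\<lambda>n. norm (x - q n)) \<longlonglongrightarrow> norm (x - p)" by (intro tendsto_intros p)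
  then have "norm (x - p) = infdist x S" using lim LIMSEQ_unique by blast
  then show ?thesis using nearest_point_unique[OF uc S(1) pS] p by simp
qed

text \<open>The nearest points of \<open>x n\<close> form a minimizing sequence for
  \<open>y\<close>, and minimizing sequences converge to the nearest point.\<close>

lemma nearest_point_continuous:
  fixes y :: "'a::banach"
  assumes uc: "uniformly_convex_space TYPE('a)" and S: "convex S" "closed S" "S \<noteq> {}"
    and lim: "x \<longlonglongrightarrow> y"
  shows "(\<lambda>n. nearest_point S (x n)) \<longlonglongrightarrow> nearest_point S y"
proof (rule tendsto_nearest_point[OF uc S(1,2)])
  show "nearest_point S (x n) \<in> S" for n by (rule nearest_point[OF uc S])
  have upper: "norm (y - nearest_point S (x n)) \<le> norm (y - x n) + infdist (x n) S" for n
    using norm_triangle_ineq[of "y - x n" "x n - nearest_point S (x n)"] nearest_point(2)[OF uc S] by simp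
  have lower: "infdist y S \<le> norm (y - nearest_point S (x n))" for n
    using infdist_le[OF nearest_point(1)[OF uc S]] by (simp add: dist_norm)
  have bound: "(\<lambda>n. norm (y - x n) + infdist (x n) S) \<longlonglongrightarrow> infdist y S"
    using tendsto_add[OF tendsto_norm[OF tendsto_diff[OF tendsto_const[of y] lim]] tendsto_infdist[OF lim, of S]]
    by simp
  show "(\<lambda>n. norm (y - nearest_point S (x n))) \<longlonglongrightarrow> infdist y S"
    using lower upper by (intro tendsto_sandwich[OF _ _ tendsto_const bound] always_eventually) auto
qed

text \<open>Moving from the nearest point towards \<open>q\<close> stays in \<open>S\<close> by
  convexity, so the distance to \<open>x\<close> cannot drop below its minimum.\<close>

lemma nearest_point_variational:
  fixes x :: "'a::banach"
  assumes uc: "uniformly_convex_space TYPE('a)"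
    and dual_2uc: "two_uniformly_convex_space TYPE('a \<Rightarrow>\<^sub>L real)"
    and S: "convex S" "closed S" and q: "q \<in> S"
  shows "0 \<le> duality_pairing (x - nearest_point S x) (nearest_point S x - q)"
proof (rule duality_pairing_nonneg_of_norm_le[OF dual_2uc])
  fix t :: real assume t: "0 < t" "t < 1"
  let ?p = "nearest_point S x"
  have ne: "S \<noteq> {}" using q by blast
  have "(1 - t) *\<^sub>R ?p + t *\<^sub>R q \<in> S"
    using S(1) nearest_point(1)[OF uc S ne] q t by (intro convexD) auto
  then have "infdist x S \<le> norm (x - ((1 - t) *\<^sub>R ?p + t *\<^sub>R q))"
    by (metis infdist_le dist_norm)
  also have "x - ((1 - t) *\<^sub>R ?p + t *\<^sub>R q) = (x - ?p) + t *\<^sub>R (?p - q)"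
    by (simp add: algebra_simps)
  finally show "norm (x - ?p) \<le> norm ((x - ?p) + t *\<^sub>R (?p - q))"
    using nearest_point(2)[OF uc S ne] by simp
qed

lemma infdist_sq_subgradient:
  fixes x w :: "'a::banach"
  assumes uc: "uniformly_convex_space TYPE('a)"
    and dual_2uc: "two_uniformly_convex_space TYPE('a \<Rightarrow>\<^sub>L real)"
    and S: "convex S" "closed S" "S \<noteq> {}"
  shows "(infdist x S)\<^sup>2 + 2 * duality_pairing (x - nearest_point S x) (w - x) \<le> (infdist w S)\<^sup>2"
proof -
  let ?P = "nearest_point S"
  have "(norm (x - ?P x))\<^sup>2 + 2 * duality_pairing (x - ?P x) ((w - ?P w) - (x - ?P x)) \<le> (norm (w - ?P w))\<^sup>2"
    by (rule duality_pairing_subgradient[OF dual_2uc])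
  moreover have "(w - ?P w) - (x - ?P x) = (w - x) + (?P x - ?P w)" by simp
  moreover have "0 \<le> duality_pairing (x - ?P x) (?P x - ?P w)"
    using nearest_point(1)[OF uc S] by (intro nearest_point_variational assms)
  ultimately show ?thesis by (simp add: nearest_point(2)[OF uc S] blinfun.add_right)
qed

section \<open>Fixed point sets and nested convex sets\<close>

lemma strictly_convex_midpoint:
  fixes a b :: "'a::real_normed_vector"
  assumes uc: "uniformly_convex_space TYPE('a)" and ab: "norm a \<le> R" "norm b \<le> R" "a \<noteq> b"
  shows "norm ((a + b) /\<^sub>R 2) < R"
proof -
  have e: "norm (a - b) > 0" using ab by simp
  obtain \<eta> where \<eta>: "\<eta> > 0" and gap: "\<And>a' b' :: 'a. norm a' \<le> R \<Longrightarrow> norm b' \<le> R \<Longrightarrow>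
      norm (a - b) \<le> norm (a' - b') \<Longrightarrow> (norm ((a' + b') /\<^sub>R 2))\<^sup>2 \<le> ((norm a')\<^sup>2 + (norm b')\<^sup>2) / 2 - \<eta>"
    by (rule midpoint_gap_uniform[OF uc e, of R]) (rule that)
  have "(norm ((a + b) /\<^sub>R 2))\<^sup>2 \<le> ((norm a)\<^sup>2 + (norm b)\<^sup>2) / 2 - \<eta>"
    using ab by (intro gap) auto
  moreover have "(norm a)\<^sup>2 \<le> R\<^sup>2" "(norm b)\<^sup>2 \<le> R\<^sup>2" using ab by (auto intro: power_mono)
  ultimately have "(norm ((a + b) /\<^sub>R 2))\<^sup>2 < R\<^sup>2" using \<eta> by argo
  then show ?thesis by (rule power2_less_imp_less) (rule order_trans[OF norm_ge_zero ab(1)])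
qed

text \<open>The image of a point \<open>?m\<close> of the segment is no farther from
  \<open>p\<close> and \<open>q\<close> than \<open>?m\<close> is. Were it different, its midpoint
  with \<open>?m\<close> would be strictly nearer to \<open>p\<close>, against the triangle
  inequality for \<open>p\<close> and \<open>q\<close>.\<close>

lemma convex_fixed_points_nonexpansive:
  fixes T :: "'a::real_normed_vector \<Rightarrow> 'a"
  assumes uc: "uniformly_convex_space TYPE('a)" and T: "\<And>x y. norm (T x - T y) \<le> norm (x - y)"
  shows "convex {x. T x = x}"
proof (rule convexI, clarsimp)
  fix p q :: 'a and s t :: real
  assume pq: "T p = p" "T q = q" and st: "0 \<le> s" "0 \<le> t" "s + t = 1"
  let ?m = "s *\<^sub>R p + t *\<^sub>R q" and ?D = "norm (p - q)"
  have s: "s = 1 - t" using st by simp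
  have "?m - p = t *\<^sub>R (q - p)" "?m - q = s *\<^sub>R (p - q)" by (simp_all add: s algebra_simps)
  then have m: "norm (?m - p) = t * ?D" "norm (?m - q) = s * ?D"
    using st by (simp_all add: norm_minus_commute)
  have Tm: "norm (T ?m - p) \<le> t * ?D" "norm (T ?m - q) \<le> s * ?D"
    using T[of ?m p] T[of ?m q] m pq by auto
  show "T ?m = ?m"
  proof (rule ccontr)
    assume "T ?m \<noteq> ?m"
    let ?a = "((T ?m - p) + (?m - p)) /\<^sub>R 2" and ?b = "((T ?m - q) + (?m - q)) /\<^sub>R 2"
    have "norm ?a < t * ?D"
      using Tm m \<open>T ?m \<noteq> ?m\<close> by (intro strictly_convex_midpoint[OF uc]) auto
    moreover have "norm ?b \<le> s * ?D"
      using norm_triangle_ineq[of "T ?m - q" "?m - q"] Tm m by simp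
    moreover have "?b - ?a = p - q" by (simp add: algebra_simps flip: scaleR_add_left)
    then have "?D \<le> norm ?a + norm ?b" using norm_triangle_ineq4[of ?b ?a] by simp
    ultimately have "?D < t * ?D + s * ?D" by linarith
    also have "\<dots> = ?D" by (simp add: s algebra_simps)
    finally show False by simp
  qed
qed

text \<open>This replaces weak sequential compactness of bounded sets: no reflexivity argument is needed.\<close>
lemma bounded_closed_convex_nest:
  fixes C :: "nat \<Rightarrow> 'a::banach set"
  assumes uc: "uniformly_convex_space TYPE('a)"
    and C: "\<And>n. convex (C n)" "\<And>n. closed (C n)" "\<And>n. C n \<noteq> {}"
    and dec: "\<And>m n. m \<le> n \<Longrightarrow> C n \<subseteq> C m" and bd: "bounded (C 0)"
  shows "(\<Inter>n. C n) \<noteq> {}"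
proof -
  \<comment> \<open>The points of least norm form a Cauchy sequence: their norms increase to a
    limit, and for \<open>m < n\<close> the midpoint of \<open>c m\<close> and \<open>c n\<close>
    lies in \<open>C m\<close>, so its norm is at least \<open>d m\<close>.\<close>
  define c where "c n = nearest_point (C n) 0" for n
  define d where "d n = infdist 0 (C n)" for n
  have c: "c n \<in> C n" "norm (c n) = d n" for n
    using nearest_point[OF uc C(1)[of n] C(2)[of n] C(3)[of n], of 0] by (auto simp: c_def d_def)
  obtain R where R: "\<And>v. v \<in> C 0 \<Longrightarrow> norm v \<le> R" using bd by (auto simp: bounded_iff)
  have dR: "d n \<le> R" for n using R c dec[of 0 n] by (metis le0 subsetD)
  have d0: "0 \<le> d n" for n by (simp add: d_def infdist_nonneg)
  have mono: "d m \<le> d n" if "m \<le> n" for m n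
    unfolding d_def using dec[OF that] C by (intro infdist_mono) auto
  have "incseq (\<lambda>n. (d n)\<^sup>2)" using mono d0 by (auto simp: incseq_def intro: power_mono)
  then obtain l where "(\<lambda>n. (d n)\<^sup>2) \<longlonglongrightarrow> l"
    using incseq_convergent[of "\<lambda>n. (d n)\<^sup>2" "R\<^sup>2"] dR d0 by (meson power_mono)
  then have Cd: "Cauchy (\<lambda>n. (d n)\<^sup>2)" by (rule LIMSEQ_imp_Cauchy)
  have "Cauchy c"
  proof (rule CauchyI')
    fix e :: real assume e: "e > 0"
    obtain \<eta> where \<eta>: "\<eta> > 0" and gap: "\<And>a b :: 'a. norm a \<le> R \<Longrightarrow> norm b \<le> R \<Longrightarrow>
        e \<le> norm (a - b) \<Longrightarrow> (norm ((a + b) /\<^sub>R 2))\<^sup>2 \<le> ((norm a)\<^sup>2 + (norm b)\<^sup>2) / 2 - \<eta>"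
      by (rule midpoint_gap_uniform[OF uc e, of R]) (rule that)
    obtain N where N: "\<And>m n. m \<ge> N \<Longrightarrow> n \<ge> N \<Longrightarrow> norm ((d m)\<^sup>2 - (d n)\<^sup>2) < \<eta>"
      using CauchyD[OF Cd \<eta>] by blast
    have "norm (c m - c n) < e" if "N \<le> m" "m < n" for m n
    proof (rule ccontr)
      assume "\<not> norm (c m - c n) < e"
      then have le: "(norm ((c m + c n) /\<^sub>R 2))\<^sup>2 \<le> ((d m)\<^sup>2 + (d n)\<^sup>2) / 2 - \<eta>"
        using gap[of "c m" "c n"] c dR by auto
      have "c n \<in> C m" using c dec[of m n] that by auto
      then have "(1/2) *\<^sub>R c m + (1/2) *\<^sub>R c n \<in> C m" using c C by (intro convexD) auto
      then have "d m \<le> norm ((c m + c n) /\<^sub>R 2)"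
        using infdist_le[of "(1/2) *\<^sub>R c m + (1/2) *\<^sub>R c n" "C m" 0] by (simp add: d_def inverse_eq_divide flip: scaleR_add_right)
      then have "(d m)\<^sup>2 \<le> (norm ((c m + c n) /\<^sub>R 2))\<^sup>2" using d0 by (intro power_mono)
      moreover have "(d n)\<^sup>2 - (d m)\<^sup>2 < \<eta>" using N[of n m] that by auto
      ultimately show False using le \<eta> by argo
    qed
    then show "\<exists>M. \<forall>m\<ge>M. \<forall>n>m. dist (c m) (c n) < e" by (auto simp: dist_norm)
  qed
  then obtain p where p: "c \<longlonglongrightarrow> p" by (auto simp: Cauchy_convergent_iff convergent_def)
  have "p \<in> C n" for n
  proof (rule Lim_in_closed_set[OF C(2) _ _ p])
    show "\<forall>\<^sub>F k in sequentially. c k \<in> C n"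
      using c(1) dec unfolding eventually_sequentially by (meson subsetD)
  qed simp
  then show ?thesis by blast
qed

section \<open>Accretive operators\<close>

lemma summable_of_descent:
  fixes a c e :: "nat \<Rightarrow> real"
  assumes "\<And>n. a (Suc n) + c n \<le> a n + e n" "\<And>n. 0 \<le> a n" "\<And>n. 0 \<le> c n" "\<And>n. 0 \<le> e n" "summable e"
  shows "summable c"
proof (rule summableI_nonneg_bounded)
  have le: "a n + (\<Sum>k<n. c k) \<le> a 0 + (\<Sum>k<n. e k)" for n
  proof (induction n)
    case (Suc n)
    then show ?case using assms(1)[of n] by simp
  qed simp
  have "(\<Sum>k<n. e k) \<le> suminf e" for n using assms by (intro sum_le_suminf) auto
  then show "(\<Sum>k<n. c k) \<le> a 0 + suminf e" for n using le[of n] assms(2)[of n] by (meson add_left_mono le_add_same_cancel2 order_trans)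
qed (use assms in auto)

lemma convergent_of_quasi_decreasing:
  fixes a e :: "nat \<Rightarrow> real"
  assumes "\<And>n. a (Suc n) \<le> a n + e n" "\<And>n. 0 \<le> a n" "\<And>n. 0 \<le> e n" "summable e"
  shows "convergent a"
proof -
  \<comment> \<open>Subtracting the accumulated errors turns a quasi-decreasing sequence into a
    decreasing one.\<close>
  let ?b = "\<lambda>n. a n - (\<Sum>k<n. e k)"
  have "decseq ?b" using assms(1) by (intro decseq_SucI) (simp add: algebra_simps)
  moreover have "- suminf e \<le> ?b n" for n
    using sum_le_suminf[OF assms(4), of "{..<n}"] assms(2)[of n] assms(3) by auto
  ultimately obtain l where "?b \<longlonglongrightarrow> l"
    using decseq_convergent[of ?b "- suminf e"] by blast
  from tendsto_add[OF this summable_LIMSEQ[OF assms(4)]] show ?thesis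
    by (auto simp: convergent_def)
qed

text \<open>If \<open>t\<close> stayed above some \<open>e > 0\<close> from an index on,
  \<open>l\<close> would be dominated by \<open>l n * t n / e\<close> and hence summable.\<close>

lemma subseq_tendsto_zero_of_summable_mult:
  fixes l t :: "nat \<Rightarrow> real"
  assumes l: "\<And>n. 0 \<le> l n" "\<not> summable l" and t: "\<And>n. 0 \<le> t n" and sum: "summable (\<lambda>n. l n * t n)"
  obtains r :: "nat \<Rightarrow> nat" where "strict_mono r" "(\<lambda>n. t (r n)) \<longlonglongrightarrow> 0"
proof -
  have ex: "\<exists>n>N. t n < e" if "e > 0" for e N
  proof (rule ccontr)
    assume none: "\<not> ?thesis"
    have ge: "e \<le> t n" if "n > N" for n using none that by (meson not_le)
    have "summable l"
    proof (rule summable_comparison_test')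
      show "summable (\<lambda>n. (1 / e) * (l n * t n))" by (intro summable_mult sum)
    next
      fix n assume "Suc N \<le> n"
      then have "l n * e \<le> l n * t n" using ge l by (intro mult_left_mono) auto
      then show "norm (l n) \<le> (1 / e) * (l n * t n)" using that l by (simp add: field_simps)
    qed
    then show False using l by blast
  qed
  have "\<exists>f. \<forall>n. t (f n) < 1 / real (Suc n) \<and> f n < f (Suc n)"
  proof (rule dependent_nat_choice)
    show "\<exists>x. t x < 1 / real (Suc 0)" using ex[of 1 0] by auto
    show "\<exists>y. t y < 1 / real (Suc (Suc n)) \<and> x < y" for x n
      using ex[of "1 / real (Suc (Suc n))" x] by auto
  qed
  then obtain f where f: "\<And>n. t (f n) < 1 / real (Suc n)" "\<And>n. f n < f (Suc n)" by blast
  have "(\<lambda>n. t (f n)) \<longlonglongrightarrow> 0"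
    by (intro tendsto_sandwich[OF _ _ tendsto_const LIMSEQ_Suc[OF lim_1_over_n]] always_eventually)
      (use f(1) t in \<open>auto intro: less_imp_le\<close>)
  then show ?thesis using that[of f] f(2) by (simp add: strict_mono_Suc_iff)
qed

lemma tendsto_blinfun_zero_bounded:
  fixes f :: "nat \<Rightarrow> 'a::real_normed_vector \<Rightarrow>\<^sub>L real"
  assumes "f \<longlonglongrightarrow> 0" "\<And>n. norm (v n) \<le> K"
  shows "(\<lambda>n. blinfun_apply (f n) (v n)) \<longlonglongrightarrow> 0"
proof (rule Lim_null_comparison)
  show "\<forall>\<^sub>F n in sequentially. norm (blinfun_apply (f n) (v n)) \<le> norm (f n) * K"
    by (intro always_eventually allI order_trans[OF norm_blinfun] mult_left_mono assms(2) norm_ge_zero)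
  show "(\<lambda>n. norm (f n) * K) \<longlonglongrightarrow> 0"
    by (rule tendsto_mult_left_zero[OF tendsto_norm_zero[OF assms(1)]])
qed

text \<open>Passage to the limit for the substitute of a weak limit: a closed half-space that
  contains a tail of \<open>v\<close> contains its closed convex hull, hence
  \<open>c\<close>.\<close>

lemma closed_hull_tail_lower_bound:
  fixes f :: "'a::real_normed_vector \<Rightarrow>\<^sub>L real"
  assumes c: "\<And>n. c \<in> closure (convex hull (v ` {n..}))"
    and h: "h \<longlonglongrightarrow> H" "\<And>n. h n \<le> blinfun_apply f (v n)"
  shows "H \<le> blinfun_apply f c"
proof (rule field_le_epsilon)
  fix \<delta> :: real assume "\<delta> > 0"
  then have "\<forall>\<^sub>F n in sequentially. H - \<delta> < h n" using h(1) by (intro order_tendstoD) auto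
  then obtain N where N: "\<And>n. n \<ge> N \<Longrightarrow> H - \<delta> < h n" by (auto simp: eventually_sequentially)
  let ?S = "{w. H - \<delta> \<le> blinfun_apply f w}"
  have "?S = blinfun_apply f -` {H - \<delta>..}" by auto
  then have "convex ?S"
    using convex_linear_vimage[of "blinfun_apply f" "{H - \<delta>..}"]
    by (simp add: blinfun.bounded_linear_right bounded_linear.linear)
  moreover have "v ` {N..} \<subseteq> ?S" using order_trans[OF less_imp_le[OF N] h(2)] by auto
  ultimately have "convex hull (v ` {N..}) \<subseteq> ?S" by (intro hull_minimal)
  moreover have "closed ?S" by (intro closed_Collect_le continuous_intros)
  ultimately have "closure (convex hull (v ` {N..})) \<subseteq> ?S" by (rule closure_minimal)
  then show "H \<le> blinfun_apply f c + \<delta>" using c[of N] by auto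
qed

section \<open>Resolvents and maximality\<close>

lemma accretive_resolvent_nonexpansive:
  assumes "accretive A" "u \<in> A x" "v \<in> A y" "l > 0"
  shows "norm (x - y) \<le> norm ((x + l *\<^sub>R u) - (y + l *\<^sub>R v))"
proof -
  have "norm (x - y) \<le> norm (x - y + l *\<^sub>R (u - v))" using assms unfolding accretive_def by blast
  then show ?thesis by (simp add: algebra_simps)
qed

lemma resolvent_eq:
  assumes "accretive A" "u \<in> A x" "l > 0"
  shows "resolvent A l (x + l *\<^sub>R u) = x"
  unfolding resolvent_def
proof (rule the_equality)
  fix y assume "\<exists>v\<in>A y. x + l *\<^sub>R u = y + l *\<^sub>R v"
  then obtain v where "v \<in> A y" "x + l *\<^sub>R u = y + l *\<^sub>R v" by blast
  then show "y = x" using accretive_resolvent_nonexpansive[OF assms(1,2) _ assms(3), of v y] by simp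
qed (use assms in blast)

lemma resolvent_obtain:
  assumes "m_accretive A" "l > 0"
  obtains u where "u \<in> A (resolvent A l z)" "z = resolvent A l z + l *\<^sub>R u"
proof -
  obtain x u where xu: "u \<in> A x" "z = x + l *\<^sub>R u" using assms unfolding m_accretive_def by blast
  moreover have "resolvent A l z = x"
    using assms xu by (simp add: m_accretive_def resolvent_eq)
  ultimately show ?thesis using that by metis
qed

lemma norm_resolvent_diff_le:
  assumes "m_accretive A" "l > 0"
  shows "norm (resolvent A l z - resolvent A l w) \<le> norm (z - w)"
proof -
  obtain u v where "u \<in> A (resolvent A l z)" "z = resolvent A l z + l *\<^sub>R u"
    "v \<in> A (resolvent A l w)" "w = resolvent A l w + l *\<^sub>R v"
    using resolvent_obtain[OF assms] by metis
  then show ?thesis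
    using accretive_resolvent_nonexpansive[of A u "resolvent A l z" v "resolvent A l w" l] assms
    by (simp add: m_accretive_def)
qed

text \<open>Membership in the graph is the resolvent equation \<open>?J (x n + u n) = x n\<close>,
  which survives the limit because the resolvent is nonexpansive.\<close>

lemma m_accretive_closed_graph:
  assumes A: "m_accretive A" and lim: "x \<longlonglongrightarrow> x'" "u \<longlonglongrightarrow> u'" and u: "\<And>n. u n \<in> A (x n)"
  shows "u' \<in> A x'"
proof -
  let ?J = "resolvent A 1"
  have J: "?J (x n + u n) = x n" for n
    using resolvent_eq[of A "u n" "x n" 1] A u by (simp add: m_accretive_def)
  have "(\<lambda>n. norm ((x n + u n) - (x' + u'))) \<longlonglongrightarrow> 0"
    by (intro tendsto_norm_zero LIM_zero tendsto_add lim)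
  then have "(\<lambda>n. x n - ?J (x' + u')) \<longlonglongrightarrow> 0"
    by (rule Lim_null_comparison[rotated])
      (metis (no_types, lifting) J always_eventually norm_resolvent_diff_le[OF A zero_less_one])
  then have "x' = ?J (x' + u')" using lim(1) LIMSEQ_unique LIM_zero_cancel by blast
  then show ?thesis using resolvent_obtain[OF A zero_less_one, of "x' + u'"] by (metis add_left_cancel scaleR_one)
qed

text \<open>Minty's argument: the inequality is tested at the resolvent point of
  \<open>x + u\<close>, where \<open>u - w\<close> is the negative of \<open>x - ?z\<close>, so that
  the two points coincide.\<close>

lemma m_accretive_maximal:
  fixes A :: "'a::real_normed_vector \<Rightarrow> 'a set"
  assumes dual_2uc: "two_uniformly_convex_space TYPE('a \<Rightarrow>\<^sub>L real)"
    and A: "m_accretive A" and le: "\<And>z w. w \<in> A z \<Longrightarrow> 0 \<le> duality_pairing (x - z) (u - w)"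
  shows "u \<in> A x"
proof -
  let ?z = "resolvent A 1 (x + u)"
  obtain w where w: "w \<in> A ?z" "x + u = ?z + w"
    using resolvent_obtain[OF A zero_less_one, of "x + u"] by auto
  have "u - w = - (x - ?z)" using w(2) by (simp add: algebra_simps)
  then have "0 \<le> - (norm (x - ?z))\<^sup>2"
    using le[OF w(1)] by (simp only: blinfun.minus_right duality_pairing_self[OF dual_2uc])
  then have "x = ?z" by simp
  then show ?thesis using w by (metis add_left_cancel)
qed

section \<open>The sum of an m-accretive and a cocoercive operator\<close>

text \<open>The smoothness constant \<kappa> is a parameter so that the bound on the step sizes can
  refer to it.\<close>

locale cocoercive_sum =
  fixes A :: "'a::banach \<Rightarrow> 'a set" and B :: "'a \<Rightarrow> 'a" and \<theta> \<kappa> :: real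
  assumes uc: "uniformly_convex_space TYPE('a)"
    and dual_2uc: "two_uniformly_convex_space TYPE('a \<Rightarrow>\<^sub>L real)"
    and A: "m_accretive A"
    and \<theta>: "\<theta> > 0" and B: "cocoercive B \<theta>"
    and \<kappa>: "\<kappa> > 0"
    and smooth: "\<And>u v :: 'a. (norm (u + v))\<^sup>2 \<le> (norm u)\<^sup>2 + 2 * duality_pairing u v + \<kappa> * (norm v)\<^sup>2"
begin

abbreviation \<Sigma> :: "'a set" where "\<Sigma> \<equiv> zeros (operator_sum A B)"

lemma A_accretive: "accretive A" using A by (simp add: m_accretive_def)

lemma mem_zeros_iff: "x \<in> \<Sigma> \<longleftrightarrow> - B x \<in> A x"
proof
  assume "x \<in> \<Sigma>"
  then obtain u where "u \<in> A x" "0 = u + B x" by (auto simp: zeros_def operator_sum_def)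
  then show "- B x \<in> A x" by (metis add.commute neg_eq_iff_add_eq_0)
qed (force simp: zeros_def operator_sum_def)

text \<open>Cocoercivity with the norm bound on the pairing, divided by
  \<open>norm (B x - B y)\<close>.\<close>

lemma B_Lipschitz: "norm (B x - B y) \<le> norm (x - y) / \<theta>"
proof -
  have "\<theta> * (norm (B x - B y))\<^sup>2 \<le> norm (x - y) * norm (B x - B y)"
    using B duality_pairing_le[OF dual_2uc, of "x - y" "B x - B y"] unfolding cocoercive_def
    by (meson order_trans)
  then have "norm (B x - B y) * (\<theta> * norm (B x - B y)) \<le> norm (B x - B y) * norm (x - y)"
    by (simp add: power2_eq_square mult_ac)
  then have "\<theta> * norm (B x - B y) \<le> norm (x - y)"
    by (cases "B x = B y") (auto simp: mult_le_cancel_left)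
  then show ?thesis using \<theta> by (simp add: field_simps)
qed

lemma tendsto_B: "x \<longlonglongrightarrow> y \<Longrightarrow> (\<lambda>n. B (x n)) \<longlonglongrightarrow> B y"
proof -
  assume "x \<longlonglongrightarrow> y"
  then have "(\<lambda>n. norm (x n - y) / \<theta>) \<longlonglongrightarrow> 0"
    by (intro tendsto_divide_zero tendsto_norm_zero LIM_zero)
  then have "(\<lambda>n. B (x n) - B y) \<longlonglongrightarrow> 0"
    by (rule Lim_null_comparison[rotated]) (simp add: B_Lipschitz)
  then show ?thesis by (rule LIM_zero_cancel)
qed

text \<open>In the smoothness inequality the quadratic term \<open>l\<^sup>2 * \<kappa>\<close> in
  \<open>B x - B y\<close> is absorbed by \<open>2 * l * \<theta>\<close>, which cocoercivity
  provides.\<close>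

lemma forward_nonexpansive:
  assumes l: "l > 0" "l * \<kappa> \<le> 2 * \<theta>"
  shows "norm ((x - l *\<^sub>R B x) - (y - l *\<^sub>R B y)) \<le> norm (x - y)"
proof -
  let ?b = "B x - B y"
  have "(norm ((x - y) + - (l *\<^sub>R ?b)))\<^sup>2
      \<le> (norm (x - y))\<^sup>2 + 2 * duality_pairing (x - y) (- (l *\<^sub>R ?b)) + \<kappa> * (norm (- (l *\<^sub>R ?b)))\<^sup>2"
    by (rule smooth)
  also have "\<dots> = (norm (x - y))\<^sup>2 - l * (2 * duality_pairing (x - y) ?b - l * \<kappa> * (norm ?b)\<^sup>2)"
    unfolding blinfun.minus_right blinfun.scaleR_right norm_minus_cancel norm_scaleR power_mult_distrib
    by (simp add: power2_eq_square[of l] right_diff_distrib)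
  also have "\<dots> \<le> (norm (x - y))\<^sup>2"
  proof -
    have "l * \<kappa> * (norm ?b)\<^sup>2 \<le> 2 * \<theta> * (norm ?b)\<^sup>2" using l by (intro mult_right_mono) auto
    also have "\<dots> \<le> 2 * duality_pairing (x - y) ?b"
      using B unfolding cocoercive_def by (simp add: mult.assoc)
    finally show ?thesis using l by simp
  qed
  finally have "norm ((x - y) + - (l *\<^sub>R ?b)) \<le> norm (x - y)" by (rule power2_le_imp_le) simp
  then show ?thesis by (simp add: algebra_simps)
qed

definition forward_backward :: "real \<Rightarrow> 'a \<Rightarrow> 'a" where
  "forward_backward l x = resolvent A l (x - l *\<^sub>R B x)"

lemma zeros_eq_fixed_points:
  assumes "l > 0"
  shows "\<Sigma> = {x. forward_backward l x = x}"
proof (intro set_eqI iffI CollectI)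
  fix x assume "x \<in> \<Sigma>"
  then show "forward_backward l x = x"
    using resolvent_eq[OF A_accretive _ assms, of "- B x" x] by (simp add: mem_zeros_iff forward_backward_def)
next
  fix x assume "x \<in> {x. forward_backward l x = x}"
  then have fix_x: "resolvent A l (x - l *\<^sub>R B x) = x" by (simp add: forward_backward_def)
  obtain u where "u \<in> A x" "x - l *\<^sub>R B x = x + l *\<^sub>R u"
    using resolvent_obtain[OF A assms, of "x - l *\<^sub>R B x"] unfolding fix_x by blast
  moreover from this have "l *\<^sub>R u = l *\<^sub>R (- B x)" by (simp add: algebra_simps eq_neg_iff_add_eq_0)
  then have "u = - B x" using assms by (simp only: scaleR_cancel_left) simp
  ultimately show "x \<in> \<Sigma>" by (simp add: mem_zeros_iff)
qed

lemma forward_backward_nonexpansive: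
  assumes "l > 0" "l * \<kappa> \<le> 2 * \<theta>"
  shows "norm (forward_backward l x - forward_backward l y) \<le> norm (x - y)"
  unfolding forward_backward_def
  using norm_resolvent_diff_le[OF A assms(1)] forward_nonexpansive[OF assms] by (meson order_trans)

lemma convex_zeros: "convex \<Sigma>"
proof -
  \<comment> \<open>The largest step that \<open>forward_nonexpansive\<close> admits; every positive
    step has the same fixed points.\<close>
  have l: "2 * \<theta> / \<kappa> > 0" "2 * \<theta> / \<kappa> * \<kappa> \<le> 2 * \<theta>" using \<theta> \<kappa> by auto
  show ?thesis
    unfolding zeros_eq_fixed_points[OF l(1)]
    by (rule convex_fixed_points_nonexpansive[OF uc forward_backward_nonexpansive[OF l]])
qed

lemma closed_zeros: "closed \<Sigma>"
  unfolding closed_sequential_limits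
proof (intro allI impI, elim conjE)
  fix x y assume "\<forall>n. x n \<in> \<Sigma>" and lim: "x \<longlonglongrightarrow> y"
  then have "- B (x n) \<in> A (x n)" for n by (simp add: mem_zeros_iff)
  then show "y \<in> \<Sigma>"
    unfolding mem_zeros_iff
    by (rule m_accretive_closed_graph[OF A lim tendsto_minus[OF tendsto_B[OF lim]]])
qed

end

section \<open>The forward-backward iteration\<close>

text \<open>\<open>L n\<close> and \<open>E n\<close> belong to the step from \<open>X n\<close> to
  \<open>X (Suc n)\<close>. All steps are assumed small; an initial segment is discarded to reach
  this situation.\<close>

locale forward_backward_iteration = cocoercive_sum +
  fixes X E :: "nat \<Rightarrow> 'a" and L :: "nat \<Rightarrow> real"
  assumes L_pos: "\<And>n. L n > 0" and L_small: "\<And>n. L n * \<kappa> \<le> 2 * \<theta>"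
    and L_sq: "summable (\<lambda>n. (L n)\<^sup>2)" and L_div: "\<not> summable L"
    and E_sum: "summable (\<lambda>n. norm (E n))"
    and step: "\<And>n. (X n - X (Suc n)) /\<^sub>R L n + E n - B (X n) \<in> A (X (Suc n))"
    and zeros_ne: "\<Sigma> \<noteq> {}"
begin

definition a :: "nat \<Rightarrow> 'a" where "a n = (X n - X (Suc n)) /\<^sub>R L n + E n - B (X n)"

text \<open>\<open>a n\<close> is the element of \<open>A\<close> selected by the iteration; adding
  \<open>B\<close> at the new iterate, not the old one, gives an element of the sum at
  \<open>X (Suc n)\<close>.\<close>

definition y :: "nat \<Rightarrow> 'a" where "y n = a n + B (X (Suc n))"

definition D :: "nat \<Rightarrow> 'a" where "D n = X (Suc n) - X n"

definition e :: "nat \<Rightarrow> real" where "e n = L n * norm (E n)"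

abbreviation d :: "nat \<Rightarrow> real" where "d n \<equiv> infdist (X n) \<Sigma>"

lemma a_in: "a n \<in> A (X (Suc n))" using step by (simp add: a_def)

lemma y_in: "y n \<in> operator_sum A B (X (Suc n))"
  using a_in by (auto simp: operator_sum_def y_def)

lemma forward_step: "X (Suc n) + L n *\<^sub>R a n = X n - L n *\<^sub>R B (X n) + L n *\<^sub>R E n"
  using L_pos[of n] by (simp add: a_def algebra_simps)

lemma e_nonneg: "0 \<le> e n" using L_pos[of n] by (simp add: e_def)

lemma L_bound: "L n \<le> 2 * \<theta> / \<kappa>" using L_small[of n] \<kappa> by (simp add: field_simps)

lemma e_sum: "summable e"
proof (rule summable_comparison_test')
  show "summable (\<lambda>n. 2 * \<theta> / \<kappa> * norm (E n))" by (intro summable_mult E_sum)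
  show "norm (e n) \<le> 2 * \<theta> / \<kappa> * norm (E n)" if "0 \<le> n" for n
    using e_nonneg[of n] mult_right_mono[OF L_bound[of n] norm_ge_zero[of "E n"]] by (simp add: e_def)
qed

section \<open>Quasi-Fejer estimates\<close>

text \<open>A zero \<open>q\<close> is reproduced by the forward and the backward step, both
  nonexpansive; only the error term is added.\<close>

lemma fejer_step:
  assumes q: "q \<in> \<Sigma>"
  shows "norm (X (Suc n) - q) \<le> norm (X n - q) + e n"
proof -
  have "norm (X (Suc n) - q) \<le> norm ((X (Suc n) + L n *\<^sub>R a n) - (q + L n *\<^sub>R (- B q)))"
    using q a_in L_pos by (intro accretive_resolvent_nonexpansive[OF A_accretive]) (auto simp: mem_zeros_iff)
  also have "\<dots> = norm (((X n - L n *\<^sub>R B (X n)) - (q - L n *\<^sub>R B q)) + L n *\<^sub>R E n)"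
    unfolding forward_step by (simp add: algebra_simps)
  also have "\<dots> \<le> norm ((X n - L n *\<^sub>R B (X n)) - (q - L n *\<^sub>R B q)) + norm (L n *\<^sub>R E n)"
    by (rule norm_triangle_ineq)
  also have "\<dots> \<le> norm (X n - q) + e n"
    using forward_nonexpansive[OF L_pos[of n] L_small[of n], of "X n" q] L_pos[of n] by (simp add: e_def)
  finally show ?thesis .
qed

lemma fejer:
  assumes q: "q \<in> \<Sigma>" and "n \<le> m"
  shows "norm (X m - q) - (\<Sum>k<m. e k) \<le> norm (X n - q) - (\<Sum>k<n. e k)"
  using \<open>n \<le> m\<close>
proof (induction m rule: dec_induct)
  case (step m)
  then show ?case using fejer_step[OF q, of m] by simp
qed simp

lemma dist_zeros_step: "d (Suc n) \<le> d n + e n"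
proof -
  note P = nearest_point[OF uc convex_zeros closed_zeros zeros_ne]
  have "d (Suc n) \<le> norm (X (Suc n) - nearest_point \<Sigma> (X n))"
    using infdist_le[OF P(1)] by (simp add: dist_norm)
  also have "\<dots> \<le> d n + e n" using fejer_step[OF P(1), of n "X n"] by (simp add: P(2))
  finally show ?thesis .
qed

lemma dist_zeros_convergent: "convergent d"
  by (rule convergent_of_quasi_decreasing[OF dist_zeros_step infdist_nonneg e_nonneg e_sum])

lemma X_bounded:
  obtains R where "R > 0" "\<And>n. norm (X n - p) \<le> R"
proof -
  obtain q where q: "q \<in> \<Sigma>" using zeros_ne by blast
  have "norm (X n - p) \<le> norm (X 0 - q) + suminf e + norm (q - p) + 1" for n
  proof -
    have "(\<Sum>k<n. e k) \<le> suminf e" using e_nonneg by (intro sum_le_suminf e_sum) auto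
    then have "norm (X n - q) \<le> norm (X 0 - q) + suminf e" using fejer[OF q, of 0 n] by simp
    then show ?thesis using norm_triangle_ineq[of "X n - q" "q - p"] by simp
  qed
  moreover have "0 < norm (X 0 - q) + suminf e + norm (q - p) + 1"
    using suminf_nonneg[OF e_sum e_nonneg] by (simp add: add_nonneg_pos)
  ultimately show ?thesis using that by blast
qed

text \<open>The quasi-Fejer estimate at the projection of one iterate keeps all later iterates
  within its distance to \<Sigma> plus a tail of the errors.\<close>

lemma zeros_limit_of_dist:
  assumes "d \<longlonglongrightarrow> 0"
  shows "\<exists>p\<in>\<Sigma>. X \<longlonglongrightarrow> p"
proof -
  note P = nearest_point[OF uc convex_zeros closed_zeros zeros_ne]
  have near: "norm (X m - nearest_point \<Sigma> (X n)) \<le> d n + ((\<Sum>k<m. e k) - (\<Sum>k<n. e k))"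
    if "n \<le> m" for m n
    using fejer[OF P(1) that, of "X n"] by (simp add: P(2))
  have "Cauchy X"
  proof (rule metric_CauchyI)
    fix \<delta> :: real assume \<delta>: "\<delta> > 0"
    have "Cauchy (\<lambda>n. \<Sum>k<n. e k)" by (rule LIMSEQ_imp_Cauchy[OF summable_LIMSEQ[OF e_sum]])
    from CauchyD[OF this, of "\<delta> / 4"] obtain N1 where
      N1: "\<And>m n. m \<ge> N1 \<Longrightarrow> n \<ge> N1 \<Longrightarrow> norm ((\<Sum>k<m. e k) - (\<Sum>k<n. e k)) < \<delta> / 4"
      using \<delta> by auto
    have "\<forall>\<^sub>F n in sequentially. d n < \<delta> / 4" using assms \<delta> by (intro order_tendstoD) auto
    then obtain N2 where N2: "\<And>n. n \<ge> N2 \<Longrightarrow> d n < \<delta> / 4" by (auto simp: eventually_sequentially)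
    let ?N = "max N1 N2" and ?p = "nearest_point \<Sigma> (X (max N1 N2))"
    have close: "norm (X m - ?p) < \<delta> / 2" if "m \<ge> ?N" for m
    proof -
      have "norm ((\<Sum>k<m. e k) - (\<Sum>k<?N. e k)) < \<delta> / 4" using N1[of m ?N] that by simp
      moreover have "d ?N < \<delta> / 4" using N2[of ?N] by simp
      ultimately show ?thesis using near[OF that] unfolding real_norm_def by linarith
    qed
    have "dist (X m) (X n) < \<delta>" if "m \<ge> ?N" "n \<ge> ?N" for m n
      using close[OF that(1)] close[OF that(2)] norm_triangle_ineq4[of "X m - ?p" "X n - ?p"]
      by (simp add: dist_norm)
    then show "\<exists>M. \<forall>m\<ge>M. \<forall>n\<ge>M. dist (X m) (X n) < \<delta>" by blast
  qed
  then obtain p where p: "X \<longlonglongrightarrow> p" by (auto simp: Cauchy_convergent_iff convergent_def)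
  have "infdist p \<Sigma> = 0" using LIMSEQ_unique[OF tendsto_infdist[OF p] assms] .
  then have "p \<in> \<Sigma>" using in_closed_iff_infdist_zero[OF closed_zeros zeros_ne] by blast
  then show ?thesis using p by blast
qed

lemma dist_zeros_tendsto_of_subseq:
  assumes "strict_mono r" "(\<lambda>n. d (Suc (r n))) \<longlonglongrightarrow> 0"
  shows "d \<longlonglongrightarrow> 0"
proof -
  obtain l where l: "d \<longlonglongrightarrow> l" using dist_zeros_convergent by (auto simp: convergent_def)
  have "(\<lambda>n. d (Suc (r n))) \<longlonglongrightarrow> l"
    using LIMSEQ_subseq_LIMSEQ[OF LIMSEQ_Suc[OF l] assms(1)] by (simp add: o_def)
  then show ?thesis using l assms(2) LIMSEQ_unique by blast
qed

section \<open>Bounds on the speed of the iteration\<close>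

text \<open>Up to \<open>E n\<close>, \<open>y n\<close> is the difference of two forward steps
  divided by \<open>L n\<close>, and forward steps are nonexpansive.\<close>

lemma norm_y_le: "norm (y n) \<le> norm (D n) / L n + norm (E n)"
proof -
  let ?w = "(X n - L n *\<^sub>R B (X n)) - (X (Suc n) - L n *\<^sub>R B (X (Suc n)))"
  have "y n = ?w /\<^sub>R L n + E n"
    using L_pos[of n] by (simp add: y_def a_def algebra_simps)
  then have "norm (y n) \<le> norm (?w /\<^sub>R L n) + norm (E n)" by (metis norm_triangle_ineq)
  also have "norm (?w /\<^sub>R L n) = norm ?w / L n"
    using L_pos[of n] by (simp add: divide_inverse_commute)
  also have "\<dots> \<le> norm (D n) / L n"
    using forward_nonexpansive[OF L_pos[of n] L_small[of n], of "X n" "X (Suc n)"] L_pos[of n]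
    by (intro divide_right_mono) (auto simp: D_def norm_minus_commute)
  finally show ?thesis by simp
qed

text \<open>Consecutive inclusions are compared with the single step size \<open>L (Suc n)\<close>.
  All terms then collapse to \<open>y n - E (Suc n)\<close>, so the ratio of neighbouring step sizes
  does not enter.\<close>

lemma speed_step: "norm (D (Suc n)) / L (Suc n) \<le> norm (D n) / L n + (norm (E n) + norm (E (Suc n)))"
proof -
  let ?l = "L (Suc n)"
  have "norm (D (Suc n)) = norm (X (Suc n) - X (Suc (Suc n)))" by (simp add: D_def norm_minus_commute)
  also have "\<dots> \<le> norm ((X (Suc n) + ?l *\<^sub>R a n) - (X (Suc (Suc n)) + ?l *\<^sub>R a (Suc n)))"
    by (rule accretive_resolvent_nonexpansive[OF A_accretive a_in a_in L_pos])
  also have "\<dots> = norm (?l *\<^sub>R (y n - E (Suc n)))"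
    unfolding forward_step by (simp add: y_def algebra_simps)
  also have "\<dots> = ?l * norm (y n - E (Suc n))" using L_pos[of "Suc n"] by simp
  finally have "norm (D (Suc n)) / ?l \<le> norm (y n - E (Suc n))"
    using L_pos[of "Suc n"] by (simp add: field_simps)
  also have "\<dots> \<le> norm (y n) + norm (E (Suc n))" by (rule norm_triangle_ineq4)
  finally show ?thesis using norm_y_le[of n] by simp
qed

lemma D_bound:
  obtains M where "M > 0" "\<And>n. norm (D n) \<le> M * L n"
proof -
  have "convergent (\<lambda>n. norm (D n) / L n)"
  proof (rule convergent_of_quasi_decreasing[of "\<lambda>n. norm (D n) / L n", OF speed_step])
    have "summable (\<lambda>n. norm (E (Suc n)))" using E_sum summable_Suc_iff[of "\<lambda>n. norm (E n)"] by simp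
    then show "summable (\<lambda>n. norm (E n) + norm (E (Suc n)))" by (intro summable_add E_sum)
  qed (use L_pos in \<open>auto simp: less_imp_le\<close>)
  then have "Bseq (\<lambda>n. norm (D n) / L n)" by (rule convergent_imp_Bseq)
  then obtain M where M: "M > 0" "\<forall>n. norm (norm (D n) / L n) \<le> M" by (rule BseqE)
  have "norm (D n) \<le> M * L n" for n
  proof -
    have "norm (D n) / L n \<le> M" using M(2)[rule_format, of n] unfolding real_norm_def by (rule abs_le_D1)
    then show ?thesis using L_pos[of n] by (simp add: field_simps)
  qed
  then show ?thesis using that M(1) by blast
qed

text \<open>Reads the scheme as an implicit step along \<open>- y n\<close>, perturbed by the error
  and by the delay in evaluating \<open>B\<close>.\<close>

lemma D_eq: "D n = L n *\<^sub>R ((B (X (Suc n)) - B (X n)) + E n - y n)"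
  using L_pos[of n] by (simp add: D_def y_def a_def algebra_simps)

lemma y_bound:
  obtains K where "K > 0" "\<And>n. norm (y n) \<le> K"
proof -
  obtain M where M: "M > 0" "\<And>n. norm (D n) \<le> M * L n" by (rule D_bound) (rule that)
  obtain K where K: "K > 0" "\<And>n. norm (E n) \<le> K"
    using summable_imp_Bseq[OF E_sum] by (auto elim!: BseqE)
  have "norm (y n) \<le> M + K" for n
  proof -
    have "norm (D n) / L n \<le> M" using M(2)[of n] L_pos[of n] by (simp add: field_simps)
    then show ?thesis using norm_y_le[of n] K(2)[of n] by simp
  qed
  then show ?thesis using that[of "M + K"] M(1) K(1) by auto
qed

definition t :: "nat \<Rightarrow> real" where
  "t n = duality_pairing (X (Suc n) - nearest_point \<Sigma> (X (Suc n))) (y n)"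

lemma pairing_tendsto_zero_subseq:
  assumes t: "\<And>n. 0 \<le> t n"
  obtains r :: "nat \<Rightarrow> nat" where "strict_mono r" "(\<lambda>n. t (r n)) \<longlonglongrightarrow> 0"
proof -
  obtain M where M: "M > 0" "\<And>n. norm (D n) \<le> M * L n" by (rule D_bound) (rule that)
  obtain R where R: "R > 0" "\<And>n. d n \<le> R"
    using convergent_imp_Bseq[OF dist_zeros_convergent] by (auto elim!: BseqE simp: infdist_nonneg)
  \<comment> \<open>Bounds the pairing with the perturbation: \<open>e n\<close> comes from
    \<open>E n\<close>, and the delay in \<open>B\<close> costs
    \<open>L n * norm (D n) / \<theta>\<close>; \<open>R\<close> bounds the norm of the
    functional.\<close>
  let ?s = "\<lambda>n. R * (e n + M / \<theta> * (L n)\<^sup>2)"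
  have "summable (\<lambda>n. 2 * (L n * t n))"
  proof (rule summable_of_descent)
    show "summable (\<lambda>n. 2 * ?s n)" by (intro summable_mult summable_add e_sum L_sq)
    fix n
    let ?j = "X (Suc n) - nearest_point \<Sigma> (X (Suc n))"
    let ?b = "B (X (Suc n)) - B (X n)"
    have "norm ?b \<le> norm (D n) / \<theta>" using B_Lipschitz by (simp add: D_def)
    also have "\<dots> \<le> M * L n / \<theta>" using M(2) \<theta> by (intro divide_right_mono) auto
    finally have b: "L n * norm ?b \<le> M / \<theta> * (L n)\<^sup>2"
      using mult_left_mono[of "norm ?b" "M * L n / \<theta>" "L n"] L_pos[of n] by (simp add: power2_eq_square mult_ac)
    have j: "norm ?j \<le> R" using R(2) nearest_point(2)[OF uc convex_zeros closed_zeros zeros_ne] by simp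
    have "norm (L n *\<^sub>R (?b + E n)) \<le> L n * (norm ?b + norm (E n))"
      using L_pos[of n] by (simp add: norm_triangle_ineq)
    also have "\<dots> \<le> e n + M / \<theta> * (L n)\<^sup>2" using b by (simp add: e_def algebra_simps)
    finally have v: "norm (L n *\<^sub>R (?b + E n)) \<le> e n + M / \<theta> * (L n)\<^sup>2" .
    have "duality_pairing ?j (L n *\<^sub>R (?b + E n)) \<le> norm ?j * norm (L n *\<^sub>R (?b + E n))"
      by (rule duality_pairing_le[OF dual_2uc])
    also have "\<dots> \<le> ?s n" using v j R(1) by (intro mult_mono) auto
    finally have err: "duality_pairing ?j (L n *\<^sub>R (?b + E n)) \<le> ?s n" .
    have "duality_pairing ?j (D n) = duality_pairing ?j (L n *\<^sub>R (?b + E n)) - L n * t n"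
      unfolding D_eq t_def by (simp only: blinfun.scaleR_right blinfun.diff_right) (simp add: algebra_simps)
    moreover have "(d (Suc n))\<^sup>2 + 2 * duality_pairing ?j (- D n) \<le> (d n)\<^sup>2"
      using infdist_sq_subgradient[OF uc dual_2uc convex_zeros closed_zeros zeros_ne, of "X (Suc n)" "X n"]
      by (simp add: D_def)
    ultimately show "(d (Suc n))\<^sup>2 + 2 * (L n * t n) \<le> (d n)\<^sup>2 + 2 * ?s n"
      using err by (simp add: blinfun.minus_right)
    show "0 \<le> (d n)\<^sup>2" "0 \<le> 2 * (L n * t n)" using t L_pos[of n] by auto
    show "0 \<le> 2 * ?s n" using R(1) M(1) e_nonneg \<theta> by auto
  qed
  then have "summable (\<lambda>n. L n * t n)" by (simp only: summable_cmult_iff) simp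
  then show ?thesis
    using subseq_tendsto_zero_of_summable_mult[of L t] L_pos L_div t that by (metis less_imp_le)
qed

section \<open>Case (i): strong monotonicity with respect to the zero set\<close>

lemma converges_strongly_monotone:
  assumes \<alpha>: "\<alpha> > 0" and mono: "\<And>z v. z \<notin> \<Sigma> \<Longrightarrow> v \<in> operator_sum A B z \<Longrightarrow>
      \<alpha> * (norm (z - nearest_point \<Sigma> z))\<^sup>2 \<le> duality_pairing (z - nearest_point \<Sigma> z) v"
  shows "\<exists>p\<in>\<Sigma>. X \<longlonglongrightarrow> p"
proof -
  \<comment> \<open>The hypothesis speaks of points outside \<Sigma>; on \<Sigma> both sides are 0
    because \<open>duality_map 0 = 0\<close>.\<close>
  have le: "\<alpha> * (d (Suc n))\<^sup>2 \<le> t n" for n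
  proof (cases "X (Suc n) \<in> \<Sigma>")
    case True
    then have "nearest_point \<Sigma> (X (Suc n)) = X (Suc n)"
      by (intro nearest_point_unique[OF uc convex_zeros]) auto
    then show ?thesis using True by (simp add: t_def duality_map_zero[OF dual_2uc])
  next
    case False
    then show ?thesis
      using mono[OF False y_in] by (simp add: t_def nearest_point(2)[OF uc convex_zeros closed_zeros zeros_ne])
  qed
  have "0 \<le> t n" for n using \<alpha> by (intro order_trans[OF _ le]) simp
  then obtain r where r: "strict_mono r" "(\<lambda>n. t (r n)) \<longlonglongrightarrow> 0" by (rule pairing_tendsto_zero_subseq) (rule that)
  have "(\<lambda>n. \<alpha> * (d (Suc (r n)))\<^sup>2) \<longlonglongrightarrow> 0"
    using \<alpha> by (intro tendsto_sandwich[OF _ _ tendsto_const r(2)] always_eventually allI le) simp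
  then have "(\<lambda>n. (d (Suc (r n)))\<^sup>2) \<longlonglongrightarrow> 0"
    using tendsto_mult_left_iff[of \<alpha> "\<lambda>n. (d (Suc (r n)))\<^sup>2" 0] \<alpha> by simp
  from tendsto_real_sqrt[OF this] have "(\<lambda>n. d (Suc (r n))) \<longlonglongrightarrow> 0" by (simp add: infdist_nonneg)
  then show ?thesis by (intro zeros_limit_of_dist dist_zeros_tendsto_of_subseq[OF r(1)])
qed

end

context forward_backward_iteration
begin

section \<open>Case (ii): compact resolvent\<close>

lemma a_bound:
  obtains K where "\<And>n. norm (a n) \<le> K"
proof -
  obtain K where K: "\<And>n. norm (y n) \<le> K" by (rule y_bound) (rule that)
  obtain R where R: "\<And>n. norm (X n - 0) \<le> R" by (rule X_bounded) (rule that)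
  have "norm (a n) \<le> K + (R / \<theta> + norm (B 0))" for n
  proof -
    have "norm (B (X (Suc n)) - B 0) \<le> R / \<theta>"
      using order_trans[OF B_Lipschitz divide_right_mono[OF R]] \<theta> by simp
    then have "norm (B (X (Suc n))) \<le> R / \<theta> + norm (B 0)"
      using norm_triangle_ineq[of "B (X (Suc n)) - B 0" "B 0"] by simp
    then show ?thesis
      using norm_triangle_ineq4[of "y n" "B (X (Suc n))"] K[of n] by (simp add: y_def)
  qed
  then show ?thesis using that by blast
qed

text \<open>The graph of \<open>A + B\<close> is demiclosed, a weak limit of \<open>y \<circ> k\<close> being represented by any point
  common to the closed convex hulls of the tails.\<close>
lemma operator_sum_demiclosed:
  assumes lim: "(\<lambda>n. X (Suc (k n))) \<longlonglongrightarrow> x'"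
    and c: "\<And>n. c \<in> closure (convex hull ((\<lambda>n. y (k n)) ` {n..}))"
  shows "c \<in> operator_sum A B x'"
proof -
  obtain K where K: "\<And>n. norm (a n) \<le> K" by (rule a_bound) (rule that)
  have "c - B x' \<in> A x'"
  proof (rule m_accretive_maximal[OF dual_2uc A])
    fix z w assume w: "w \<in> A z"
    let ?g = "duality_map (x' - z)"
    let ?f = "\<lambda>n. ?g - duality_map (X (Suc (k n)) - z)"
    \<comment> \<open>Accretivity holds with the varying functional at
      \<open>X (Suc (k n)) - z\<close>; \<open>?h\<close> rewrites it as a lower bound for the fixed
      functional \<open>?g\<close> at \<open>y (k n)\<close>. The replacement error vanishes since
      \<open>a\<close> is bounded.\<close>
    let ?h = "\<lambda>n. blinfun_apply ?g (w + B (X (Suc (k n)))) + blinfun_apply (?f n) (a (k n) - w)"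
    have "(\<lambda>n. duality_map (X (Suc (k n)) - z)) \<longlonglongrightarrow> ?g"
      by (intro tendsto_duality_map[OF dual_2uc] tendsto_diff lim tendsto_const)
    then have "?f \<longlonglongrightarrow> 0" using tendsto_diff[OF tendsto_const[of ?g]] by fastforce
    moreover have "norm (a (k n) - w) \<le> K + norm w" for n
      using norm_triangle_ineq4[of "a (k n)" w] K[of "k n"] by simp
    ultimately have "(\<lambda>n. blinfun_apply (?f n) (a (k n) - w)) \<longlonglongrightarrow> 0"
      by (rule tendsto_blinfun_zero_bounded)
    moreover have "(\<lambda>n. blinfun_apply ?g (w + B (X (Suc (k n))))) \<longlonglongrightarrow> blinfun_apply ?g (w + B x')"
      by (intro blinfun.tendsto tendsto_add tendsto_const tendsto_B lim)
    ultimately have h: "?h \<longlonglongrightarrow> blinfun_apply ?g (w + B x')" using tendsto_add by fastforce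
    have "blinfun_apply ?g (w + B x') \<le> blinfun_apply ?g c"
    proof (rule closed_hull_tail_lower_bound[OF c h])
      fix n
      have "0 \<le> duality_pairing (X (Suc (k n)) - z) (a (k n) - w)"
        by (rule accretive_duality_pairing[OF dual_2uc A_accretive a_in w])
      then show "?h n \<le> blinfun_apply ?g (y (k n))"
        by (simp add: y_def blinfun.diff_left blinfun.diff_right blinfun.add_right)
    qed
    then show "0 \<le> duality_pairing (x' - z) (c - B x' - w)"
      by (simp add: blinfun.diff_right blinfun.add_right)
  qed
  then show ?thesis unfolding operator_sum_def by force
qed

lemma converges_compact_resolvent:
  assumes comp: "compact_map (resolvent A 1)"
    and pos: "\<And>z v. z \<notin> \<Sigma> \<Longrightarrow> v \<in> operator_sum A B z \<Longrightarrow>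
      0 < duality_pairing (z - nearest_point \<Sigma> z) v"
  shows "\<exists>p\<in>\<Sigma>. X \<longlonglongrightarrow> p"
proof -
  have "0 \<le> t n" for n
  proof (cases "X (Suc n) \<in> \<Sigma>")
    case True
    then have "nearest_point \<Sigma> (X (Suc n)) = X (Suc n)"
      by (intro nearest_point_unique[OF uc convex_zeros]) auto
    then show ?thesis by (simp add: t_def duality_map_zero[OF dual_2uc])
  next
    case False
    then show ?thesis using pos[OF False y_in] by (simp add: t_def less_imp_le)
  qed
  then obtain r where r: "strict_mono r" "(\<lambda>n. t (r n)) \<longlonglongrightarrow> 0" by (rule pairing_tendsto_zero_subseq) (rule that)
  obtain K where K: "\<And>n. norm (a n) \<le> K" by (rule a_bound) (rule that)
  obtain R where R: "\<And>n. norm (X n - 0) \<le> R" by (rule X_bounded) (rule that)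
  \<comment> \<open>Each \<open>X (Suc n)\<close> is the resolvent of the bounded vector
    \<open>X (Suc n) + a n\<close>, so compactness gives strongly convergent subsequences.\<close>
  let ?S = "range (\<lambda>n. X (Suc n) + a n)"
  have "norm (X (Suc n) + a n) \<le> R + K" for n
    using norm_triangle_ineq[of "X (Suc n)" "a n"] R[of "Suc n"] K[of n] by simp
  then have "bounded ?S" by (auto simp: bounded_iff)
  then have "compact (closure (resolvent A 1 ` ?S))" using comp by (simp add: compact_map_def)
  moreover have "X (Suc (r n)) \<in> closure (resolvent A 1 ` ?S)" for n
  proof -
    have "resolvent A 1 (X (Suc (r n)) + 1 *\<^sub>R a (r n)) = X (Suc (r n))"
      by (rule resolvent_eq[OF A_accretive a_in zero_less_one])
    then have "X (Suc (r n)) = resolvent A 1 (X (Suc (r n)) + a (r n))" by simp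
    then have "X (Suc (r n)) \<in> resolvent A 1 ` ?S" by (rule image_eqI) (rule rangeI)
    then show ?thesis by (rule subsetD[OF closure_subset])
  qed
  ultimately obtain x' s where s: "strict_mono (s :: nat \<Rightarrow> nat)" and "((\<lambda>n. X (Suc (r n))) \<circ> s) \<longlonglongrightarrow> x'"
    unfolding compact_def by meson
  then have lim: "(\<lambda>n. X (Suc (r (s n)))) \<longlonglongrightarrow> x'" by (simp add: o_def)
  have tlim: "(\<lambda>n. t (r (s n))) \<longlonglongrightarrow> 0" using LIMSEQ_subseq_LIMSEQ[OF r(2) s] by (simp add: o_def)
  let ?v = "\<lambda>n. y (r (s n))"
  obtain Ky where Ky: "\<And>n. norm (y n) \<le> Ky" by (rule y_bound) (rule that)
  \<comment> \<open>The values \<open>?v\<close> are only bounded; a point \<open>c\<close> in every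
    closed convex hull of a tail takes the place of their weak limit.\<close>
  have "(\<Inter>n. closure (convex hull (?v ` {n..}))) \<noteq> {}"
  proof (rule bounded_closed_convex_nest[OF uc])
    show "closure (convex hull (?v ` {n..})) \<subseteq> closure (convex hull (?v ` {m..}))" if "m \<le> n" for m n
      using that by (intro closure_mono hull_mono image_mono) auto
    have "bounded (?v ` {0..})" using Ky by (auto simp: bounded_iff)
    then show "bounded (closure (convex hull (?v ` {0..})))"
      by (intro bounded_closure bounded_convex_hull)
  qed (simp_all add: convex_closure)
  then obtain c where c: "\<And>n. c \<in> closure (convex hull (?v ` {n..}))" by blast
  have cin: "c \<in> operator_sum A B x'" by (rule operator_sum_demiclosed[OF lim c])
  let ?j = "\<lambda>z. duality_map (z - nearest_point \<Sigma> z)"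
  have "(\<lambda>n. ?j (X (Suc (r (s n))))) \<longlonglongrightarrow> ?j x'"
    by (intro tendsto_duality_map[OF dual_2uc] tendsto_diff lim
        nearest_point_continuous[OF uc convex_zeros closed_zeros zeros_ne])
  then have "(\<lambda>n. ?j (X (Suc (r (s n)))) - ?j x') \<longlonglongrightarrow> 0" by (rule LIM_zero)
  then have "(\<lambda>n. blinfun_apply (?j (X (Suc (r (s n)))) - ?j x') (?v n)) \<longlonglongrightarrow> 0"
    using Ky by (rule tendsto_blinfun_zero_bounded)
  \<comment> \<open>Subtracting the vanishing numbers \<open>t\<close> leaves the fixed functional
    at \<open>x'\<close> applied to \<open>?v\<close>, so its value at \<open>c\<close> is at most
    0; positivity outside \<Sigma> then puts \<open>x'\<close> into \<Sigma>.\<close>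
  from tendsto_diff[OF this tlim] have "(\<lambda>n. blinfun_apply (- ?j x') (?v n)) \<longlonglongrightarrow> 0"
    by (simp add: t_def blinfun.diff_left blinfun.minus_left)
  from closed_hull_tail_lower_bound[OF c this order_refl] have "duality_pairing (x' - nearest_point \<Sigma> x') c \<le> 0"
    by (simp add: blinfun.minus_left)
  then have "x' \<in> \<Sigma>" using pos[OF _ cin] by force
  then have "(\<lambda>n. d (Suc (r (s n)))) \<longlonglongrightarrow> 0" using tendsto_infdist[OF lim, of \<Sigma>] by simp
  then show ?thesis
    by (intro zeros_limit_of_dist dist_zeros_tendsto_of_subseq[of "\<lambda>n. r (s n)"])
      (use strict_mono_o[OF r(1) s] in \<open>simp_all add: o_def\<close>)
qed

section \<open>Case (iii): zero set with interior points\<close>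

text \<open>Since \<open>L n * norm (y n)\<close> is at most \<open>norm (D n) + e n\<close>, a
  subsequence of \<open>y\<close> tends to 0, and the closed graph of \<open>A\<close> passes this
  to the limit.\<close>

lemma limit_in_zeros_of_summable_steps:
  assumes lim: "X \<longlonglongrightarrow> p" and D: "summable (\<lambda>n. norm (D n))"
  shows "p \<in> \<Sigma>"
proof -
  have "summable (\<lambda>n. L n * norm (y n))"
  proof (rule summable_comparison_test')
    show "summable (\<lambda>n. norm (D n) + e n)" by (intro summable_add D e_sum)
    show "norm (L n * norm (y n)) \<le> norm (D n) + e n" if "0 \<le> n" for n
      using mult_left_mono[OF norm_y_le[of n], of "L n"] L_pos[of n]
      by (simp add: e_def distrib_left abs_mult)
  qed
  then obtain r where r: "strict_mono r" "(\<lambda>n. norm (y (r n))) \<longlonglongrightarrow> 0"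
    using subseq_tendsto_zero_of_summable_mult[of L "\<lambda>n. norm (y n)"] L_pos L_div by (metis less_imp_le norm_ge_zero)
  have Xr: "(\<lambda>n. X (Suc (r n))) \<longlonglongrightarrow> p"
    using LIMSEQ_subseq_LIMSEQ[OF LIMSEQ_Suc[OF lim] r(1)] by (simp add: o_def)
  have "(\<lambda>n. y (r n) - B (X (Suc (r n)))) \<longlonglongrightarrow> 0 - B p"
    by (intro tendsto_diff tendsto_norm_zero_cancel[OF r(2)] tendsto_B Xr)
  then have "(\<lambda>n. a (r n)) \<longlonglongrightarrow> - B p" by (simp add: y_def)
  then show ?thesis
    unfolding mem_zeros_iff by (rule m_accretive_closed_graph[OF A Xr]) (rule a_in)
qed

text \<open>The Fejer property at \<open>q\<close> bounds the pairing of \<open>D n\<close> with \<open>j (X - q)\<close> from above.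
  Taking \<open>q = p - \<rho> D n / norm (D n)\<close> instead of the centre \<open>p\<close> of a ball in \<open>\<Sigma>\<close> improves this
  bound by a multiple of \<open>norm (D n)\<close>, because \<open>j\<close> is uniformly monotone on bounded sets.\<close>
lemma converges_interior:
  assumes "interior \<Sigma> \<noteq> {}"
  shows "\<exists>p\<in>\<Sigma>. X \<longlonglongrightarrow> p"
proof -
  obtain p \<rho> where \<rho>: "\<rho> > 0" and ball: "cball p \<rho> \<subseteq> \<Sigma>"
    using assms mem_interior_cball by (metis ex_in_conv)
  obtain M where M: "M > 0" "\<And>n. norm (D n) \<le> M * L n" by (rule D_bound) (rule that)
  obtain R0 where R0: "R0 > 0" "\<And>n. norm (X n - p) \<le> R0" by (rule X_bounded) (rule that)
  \<comment> \<open>Enlarged by \<rho> so that it bounds the distance to every point of the ball,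
    not only to its centre.\<close>
  define R where "R = R0 + \<rho>"
  have R: "norm (X n - q) \<le> R" if "q \<in> cball p \<rho>" for n q
    using norm_triangle_ineq[of "X n - p" "p - q"] R0(2)[of n] that by (simp add: R_def dist_norm)
  obtain \<eta> where \<eta>: "\<eta> > 0" and gap: "\<And>u v :: 'a. norm u \<le> R \<Longrightarrow> norm v \<le> R \<Longrightarrow> \<rho> \<le> norm (u - v) \<Longrightarrow>
      (norm ((u + v) /\<^sub>R 2))\<^sup>2 \<le> ((norm u)\<^sup>2 + (norm v)\<^sup>2) / 2 - \<eta>"
    by (rule midpoint_gap_uniform[OF uc \<rho>, of R]) (rule that)
  \<comment> \<open>The first bracket comes from squaring the quasi-Fejer inequality, the last term
    from the smoothness inequality with \<open>norm (D n)\<close> at most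
    \<open>M * L n\<close>.\<close>
  define \<sigma> where "\<sigma> n = (2 * R * e n + (e n)\<^sup>2) + \<kappa> * (M * L n)\<^sup>2" for n
  have up: "2 * duality_pairing (X (Suc n) - q) (D n) \<le> \<sigma> n" if q: "q \<in> cball p \<rho>" for n q
  proof -
    have "q \<in> \<Sigma>" using q ball by blast
    then have "(norm (X (Suc n) - q))\<^sup>2 \<le> (norm (X n - q) + e n)\<^sup>2"
      by (intro power_mono fejer_step) auto
    also have "\<dots> = (norm (X n - q))\<^sup>2 + 2 * (norm (X n - q) * e n) + (e n)\<^sup>2"
      by (simp add: power2_eq_square algebra_simps)
    also have "\<dots> \<le> (norm (X n - q))\<^sup>2 + 2 * (R * e n) + (e n)\<^sup>2"
      using mult_right_mono[OF R[OF q, of n] e_nonneg[of n]] by simp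
    finally have 1: "(norm (X (Suc n) - q))\<^sup>2 \<le> (norm (X n - q))\<^sup>2 + 2 * (R * e n) + (e n)\<^sup>2" .
    have eq: "X (Suc n) - q + - D n = X n - q" by (simp add: D_def)
    have "(norm (X n - q))\<^sup>2 \<le> (norm (X (Suc n) - q))\<^sup>2
        - 2 * duality_pairing (X (Suc n) - q) (D n) + \<kappa> * (norm (D n))\<^sup>2"
      using smooth[of "X (Suc n) - q" "- D n"] unfolding eq by (simp add: blinfun.minus_right)
    moreover have "\<kappa> * (norm (D n))\<^sup>2 \<le> \<kappa> * (M * L n)\<^sup>2"
      using \<kappa> M(2)[of n] by (intro mult_left_mono power_mono) auto
    ultimately show ?thesis using 1 by (simp add: \<sigma>_def)
  qed
  have down: "(norm (X (Suc n) - p))\<^sup>2 - (norm (X n - p))\<^sup>2 \<le> 2 * duality_pairing (X (Suc n) - p) (D n)" for n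
    using duality_pairing_subgradient[OF dual_2uc, of "X (Suc n) - p" "X n - p"]
    by (simp add: D_def blinfun.diff_right)
  have improve: "2 * \<eta> / \<rho> * norm (D n)
      \<le> duality_pairing (X (Suc n) - (p - \<rho> *\<^sub>R sgn (D n))) (D n) - duality_pairing (X (Suc n) - p) (D n)" for n
  proof (cases "D n = 0")
    case False
    let ?u = "X (Suc n) - p" and ?v = "X (Suc n) - (p - \<rho> *\<^sub>R sgn (D n))"
    \<comment> \<open>The shift has length \<rho> along \<open>D n\<close>, so the gap of
      \<open>2 * \<eta>\<close> becomes a multiple of \<open>norm (D n)\<close> after division by
      \<open>\<rho> / norm (D n)\<close>.\<close>
    have v: "?v - ?u = (\<rho> / norm (D n)) *\<^sub>R D n" by (simp add: sgn_div_norm divide_inverse)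
    have q: "p - \<rho> *\<^sub>R sgn (D n) \<in> cball p \<rho>" "p \<in> cball p \<rho>"
      using \<rho> by (auto simp: dist_norm norm_sgn)
    have "\<rho> \<le> norm (?u - ?v)" using \<rho> False by (simp add: norm_sgn)
    then have "(norm ((?u + ?v) /\<^sub>R 2))\<^sup>2 \<le> ((norm ?u)\<^sup>2 + (norm ?v)\<^sup>2) / 2 - \<eta>"
      by (intro gap R q)
    then have "2 * \<eta> \<le> (norm ?u)\<^sup>2 + (norm ?v)\<^sup>2 - 2 * (norm ((?u + ?v) /\<^sub>R 2))\<^sup>2" by argo
    also have "\<dots> \<le> duality_pairing ?v (?v - ?u) - duality_pairing ?u (?v - ?u)"
      by (rule duality_map_monotone_gap[OF dual_2uc])
    also have "\<dots> = (\<rho> / norm (D n)) * (duality_pairing ?v (D n) - duality_pairing ?u (D n))"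
      unfolding v by (simp add: blinfun.scaleR_right right_diff_distrib)
    finally show ?thesis using False \<rho> by (simp add: field_simps)
  qed simp
  have "summable (\<lambda>n. 4 * \<eta> / \<rho> * norm (D n))"
  proof (rule summable_of_descent)
    show "(norm (X (Suc n) - p))\<^sup>2 + 4 * \<eta> / \<rho> * norm (D n) \<le> (norm (X n - p))\<^sup>2 + \<sigma> n" for n
    proof -
      \<comment> \<open>As \<open>sgn 0 = 0\<close>, the shifted point is \<open>p\<close> itself
        when \<open>D n = 0\<close>. The descent adds \<open>up\<close> at the shifted point, twice
        \<open>improve\<close>, and \<open>down\<close> at the centre.\<close>
      have "p - \<rho> *\<^sub>R sgn (D n) \<in> cball p \<rho>" using \<rho> by (auto simp: dist_norm norm_sgn)
      then show ?thesis using up[of _ n] improve[of n] down[of n] by fastforce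
    qed
    obtain K where K: "K > 0" "\<forall>n. norm (e n) \<le> K" using summable_imp_Bseq[OF e_sum] by (rule BseqE)
    have "summable (\<lambda>n. (e n)\<^sup>2)"
    proof (rule summable_comparison_test')
      show "summable (\<lambda>n. K * e n)" by (intro summable_mult e_sum)
      show "norm ((e n)\<^sup>2) \<le> K * e n" if "0 \<le> n" for n
        using mult_right_mono[OF K(2)[rule_format, of n] e_nonneg[of n]] e_nonneg[of n] by (simp add: power2_eq_square)
    qed
    then show "summable \<sigma>"
      unfolding \<sigma>_def power_mult_distrib by (intro summable_add summable_mult e_sum L_sq)
    show "0 \<le> \<sigma> n" for n using R0(1) \<rho> \<kappa> e_nonneg[of n] by (simp add: \<sigma>_def R_def)
  qed (use \<eta> \<rho> in auto)
  then have D: "summable (\<lambda>n. norm (D n))" using \<eta> \<rho> by (simp only: summable_cmult_iff) simp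
  then have "summable D" by (rule summable_norm_cancel)
  then obtain l where "(\<lambda>n. \<Sum>k<n. D k) \<longlonglongrightarrow> l" by (auto simp: summable_def sums_def)
  moreover have "(\<Sum>k<n. D k) = X n - X 0" for n by (simp add: D_def sum_lessThan_telescope)
  ultimately have "(\<lambda>n. X n - X 0) \<longlonglongrightarrow> l" by simp
  then have "(\<lambda>n. X n - X 0 + X 0) \<longlonglongrightarrow> l + X 0" by (intro tendsto_add tendsto_const)
  then have lim: "X \<longlonglongrightarrow> l + X 0" by simp
  with limit_in_zeros_of_summable_steps[OF lim D] show ?thesis by blast
qed

end

section \<open>Reduction to small steps and the three cases\<close>

theorem theorem4p5:
  fixes A :: "'a::banach \<Rightarrow> 'a set" and B :: "'a \<Rightarrow> 'a" and \<theta> :: real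
    and \<A> :: "'a \<Rightarrow> 'a set" and \<Sigma> :: "'a set"
    and lam :: "nat \<Rightarrow> real" and \<epsilon> x :: "nat \<Rightarrow> 'a"
  assumes "uniformly_convex_space TYPE('a)"
    and "two_uniformly_convex_space TYPE('a \<Rightarrow>\<^sub>L real)"
    and "m_accretive A"
    and "\<theta> > 0" and "cocoercive B \<theta>"
    and "\<And>k. k \<ge> 1 \<Longrightarrow> lam k > 0"
    and "summable (\<lambda>k. (lam (Suc k))\<^sup>2)" and "\<not> summable (\<lambda>k. lam (Suc k))"
    and "summable (\<lambda>k. norm (\<epsilon> (Suc k)))"
    and "\<And>k. k \<ge> 1 \<Longrightarrow>
           - ((x k - x (k - 1)) /\<^sub>R lam k) + \<epsilon> k \<in> {u + B (x (k - 1)) | u. u \<in> A (x k)}"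
    and "\<A> = operator_sum A B" and "\<Sigma> = zeros \<A>" and "\<Sigma> \<noteq> {}"
    and "(\<exists>\<alpha>>0. \<forall>z. z \<notin> \<Sigma> \<longrightarrow> (\<forall>y\<in>\<A> z.
             blinfun_apply (duality_map (z - nearest_point \<Sigma> z)) y
               \<ge> \<alpha> * (norm (z - nearest_point \<Sigma> z))\<^sup>2))
         \<or> (compact_map (resolvent A 1) \<and>
            (\<forall>z. z \<notin> \<Sigma> \<longrightarrow> (\<forall>y\<in>\<A> z.
               blinfun_apply (duality_map (z - nearest_point \<Sigma> z)) y > 0)))
         \<or> interior \<Sigma> \<noteq> {}"
  shows "\<exists>p\<in>\<Sigma>. x \<longlonglongrightarrow> p"
proof -
  have Sig: "\<Sigma> = zeros (operator_sum A B)" using assms(11,12) by simp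
  obtain \<kappa> where \<kappa>: "\<kappa> > 0"
    "\<And>u v :: 'a. (norm (u + v))\<^sup>2 \<le> (norm u)\<^sup>2 + 2 * duality_pairing u v + \<kappa> * (norm v)\<^sup>2"
    by (rule norm_sq_smooth[OF assms(2)]) (rule that)
  have lam_pos: "lam (Suc k) > 0" for k using assms(6)[of "Suc k"] by simp
  \<comment> \<open>Square summable step sizes tend to 0, so from some index \<open>N\<close> on
    they satisfy the smallness condition of the locale.\<close>
  have "(\<lambda>k. (lam (Suc k))\<^sup>2) \<longlonglongrightarrow> 0" using assms(7) by (rule summable_LIMSEQ_zero)
  from tendsto_real_sqrt[OF this] have "(\<lambda>k. lam (Suc k)) \<longlonglongrightarrow> 0"
    using lam_pos by (simp add: less_imp_le)
  then have "\<forall>\<^sub>F k in sequentially. lam (Suc k) < 2 * \<theta> / \<kappa>"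
    using assms(4) \<kappa>(1) by (intro order_tendstoD) auto
  then obtain N where N: "\<And>k. k \<ge> N \<Longrightarrow> lam (Suc k) < 2 * \<theta> / \<kappa>" by (auto simp: eventually_sequentially)
  \<comment> \<open>The first \<open>N\<close> iterates are dropped. The \<open>Suc\<close> appears
    because \<open>lam k\<close> and \<open>\<epsilon> k\<close> govern the step from index
    \<open>k - 1\<close> to \<open>k\<close>.\<close>
  interpret forward_backward_iteration A B \<theta> \<kappa>
    "\<lambda>n. x (n + N)" "\<lambda>n. \<epsilon> (Suc (n + N))" "\<lambda>n. lam (Suc (n + N))"
  proof unfold_locales
    show "lam (Suc (n + N)) * \<kappa> \<le> 2 * \<theta>" for n using N[of "n + N"] \<kappa>(1) by (simp add: field_simps)
    show "summable (\<lambda>n. (lam (Suc (n + N)))\<^sup>2)"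
      using assms(7) summable_iff_shift[of "\<lambda>k. (lam (Suc k))\<^sup>2" N] by simp
    show "\<not> summable (\<lambda>n. lam (Suc (n + N)))"
      using assms(8) summable_iff_shift[of "\<lambda>k. lam (Suc k)" N] by simp
    show "summable (\<lambda>n. norm (\<epsilon> (Suc (n + N))))"
      using assms(9) summable_iff_shift[of "\<lambda>k. norm (\<epsilon> (Suc k))" N] by simp
    show "(x (n + N) - x (Suc n + N)) /\<^sub>R lam (Suc (n + N)) + \<epsilon> (Suc (n + N)) - B (x (n + N)) \<in> A (x (Suc n + N))" for n
    proof -
      obtain u where u: "u \<in> A (x (Suc (n + N)))"
        "- ((x (Suc (n + N)) - x (n + N)) /\<^sub>R lam (Suc (n + N))) + \<epsilon> (Suc (n + N)) = u + B (x (n + N))"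
        using assms(10)[of "Suc (n + N)"] by auto
      then have "u = (x (n + N) - x (Suc (n + N))) /\<^sub>R lam (Suc (n + N)) + \<epsilon> (Suc (n + N)) - B (x (n + N))"
        by (simp add: algebra_simps)
      then show ?thesis using u(1) by simp
    qed
  qed (use assms \<kappa> lam_pos Sig in auto)
  from assms(14) have "\<exists>p\<in>\<Sigma>. (\<lambda>n. x (n + N)) \<longlonglongrightarrow> p"
    unfolding assms(11) Sig
    using converges_strongly_monotone converges_compact_resolvent converges_interior by blast
  then show ?thesis using LIMSEQ_offset by blast
qed

end
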